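(* Let $T>0$, let $H(p)=\frac{\langle Ap,p\rangle}{2}$ for some positive definite matrix $A\in\mathcal{M}_N(\mathbb{R})$, and let $u_T\in\mathrm{Lip}_0(\mathbb{R}^N)$. Let $\varphi^*$ be the unique minimizer of $\varphi\mapsto\|\varphi-u_T\|_{L^2(\mathbb{R}^N)}$ over the reachable set $\mathcal{R}_T$, and set $$\tilde u_0(x)=\max_{y\in\mathbb{R}^N}\Big\{\varphi^*(y)-\frac{\langle A^{-1}(y-x),y-x\rangle}{2T}\Big\}.$$ Then the set of solutions to the optimization problem $$\underset{u_0\in\mathrm{Lip}_0(\mathbb{R}^N)}{\text{minimize}}\ \|S_T^+u_0-u_T\|^2_{L^2(\mathbb{R}^N)}$$ is the convex cone in $\mathrm{Lip}(\mathbb{R}^N)$ defined as $$\mathcal{I}_T(\varphi^* )=\big\{\tilde u_0+\phi\,;\ \phi\in\mathrm{Lip}(\mathbb{R}^N)\text{ such that }\phi\ge0\text{ and }\mathrm{supp}(\phi)\subset\mathbb{R}^N\setminus X_T(\varphi^* )\big\},$$ where $$X_T(\varphi^* ):=\big\{z-TA\nabla\varphi^*(z)\,;\ z\in\mathbb{R}^N\text{ such that }\varphi^*\text{ is differentiable at }z\big\}.$$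
   Context: $\mathrm{Lip}(\mathbb{R}^N)$ is the space of Lipschitz functions $\mathbb{R}^N\to\mathbb{R}$ and $\mathrm{Lip}_0(\mathbb{R}^N)$ the subspace of those with compact support. $S_T^+u_0=u(T,\cdot)$, where $u$ is the unique viscosity solution of $\partial_tu+H(\nabla_xu)=0$ in $(0,T)\times\mathbb{R}^N$, $u(0,\cdot)=u_0$. The reachable set is $\mathcal{R}_T=\{\psi\in\mathrm{Lip}(\mathbb{R}^N):\exists u_0\in\mathrm{Lip}(\mathbb{R}^N)\text{ with }S_T^+u_0=\psi\}$. The minimizer $\varphi^*\in\mathrm{Lip}(\mathbb{R}^N)\cap L^2(\mathbb{R}^N)$ of $\|\varphi-u_T\|_{L^2}$ over $\mathcal{R}_T$ exists and is unique. The function $\tilde u_0$ is $S_T^-\varphi^*$, the backward viscosity solution at time $0$ with terminal condition $\varphi^*$ at time $T$. "Convex cone" is the paper's term for the set $\mathcal{I}_T(\varphi^* )$, which has vertex $\tilde u_0$.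
   Formalization: Here supp(φ) means the set where φ is nonzero, without closure, i.e. φ vanishes on X_T(φ* ); with the closed support the claimed equality fails, e.g. when X_T(φ* ) contains an endpoint of a gap. Positive definite means symmetric positive definite. *)

theory Defs
  imports "HOL-Analysis.Analysis"
begin

definition Lip :: "('a::metric_space \<Rightarrow> real) set" where
  "Lip = {f. \<exists>L. L-lipschitz_on UNIV f}"

definition Lip0 :: "('a::metric_space \<Rightarrow> real) set" where
  "Lip0 = {f \<in> Lip. compact (closure (support_on UNIV f))}"

(* Extended-valued: equal to \<infinity> when the measurable function f is not square integrable. *)
definition L2_norm :: "('a::euclidean_space \<Rightarrow> real) \<Rightarrow> ennreal" where
  "L2_norm f =
     (let I = (\<integral>\<^sup>+ x. ennreal ((f x)\<^sup>2) \<partial>lborel)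
      in if I = \<infinity> then \<infinity> else ennreal (sqrt (enn2real I)))"


text \<open>
  Crandall--Lions viscosity solutions of \<open>\<partial>\<^sub>t u + H (\<nabla>\<^sub>x u) = 0\<close> in
  \<open>(0,T) \<times> 'a\<close> with continuously differentiable test functions.
  In \<open>GDERIV v z :> G z\<close> the gradient \<open>G z\<close> is the pair of the time derivative and the space gradient.
\<close>

definition C1_test_function ::
  "real \<Rightarrow> (real \<times> 'a::euclidean_space \<Rightarrow> real) \<Rightarrow> (real \<times> 'a \<Rightarrow> real \<times> 'a) \<Rightarrow> bool" where
  "C1_test_function T v G \<longleftrightarrow>
     (\<forall>z \<in> {0<..<T} \<times> UNIV. GDERIV v z :> G z) \<and> continuous_on ({0<..<T} \<times> UNIV) G"

definition viscosity_subsolution ::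
  "('a::euclidean_space \<Rightarrow> real) \<Rightarrow> real \<Rightarrow> (real \<times> 'a \<Rightarrow> real) \<Rightarrow> bool" where
  "viscosity_subsolution H T u \<longleftrightarrow>
     (\<forall>v G. C1_test_function T v G \<longrightarrow>
        (\<forall>z \<in> {0<..<T} \<times> UNIV.
           (\<forall>\<^sub>F w in nhds z. u w - v w \<le> u z - v z) \<longrightarrow> fst (G z) + H (snd (G z)) \<le> 0))"

definition viscosity_supersolution ::
  "('a::euclidean_space \<Rightarrow> real) \<Rightarrow> real \<Rightarrow> (real \<times> 'a \<Rightarrow> real) \<Rightarrow> bool" where
  "viscosity_supersolution H T u \<longleftrightarrow>
     (\<forall>v G. C1_test_function T v G \<longrightarrow>
        (\<forall>z \<in> {0<..<T} \<times> UNIV.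
           (\<forall>\<^sub>F w in nhds z. u w - v w \<ge> u z - v z) \<longrightarrow> fst (G z) + H (snd (G z)) \<ge> 0))"

definition viscosity_solution ::
  "('a::euclidean_space \<Rightarrow> real) \<Rightarrow> real \<Rightarrow> ('a \<Rightarrow> real) \<Rightarrow> (real \<times> 'a \<Rightarrow> real) \<Rightarrow> bool" where
  "viscosity_solution H T u0 u \<longleftrightarrow>
     continuous_on ({0..T} \<times> UNIV) u \<and> (\<forall>x. u (0, x) = u0 x) \<and>
     viscosity_subsolution H T u \<and> viscosity_supersolution H T u"

(* The description operator is applied to the final profile, since a solution u is only
   determined on {0..T} \<times> UNIV and not as a function on the whole type. *)
definition S_plus ::
  "('a::euclidean_space \<Rightarrow> real) \<Rightarrow> real \<Rightarrow> ('a \<Rightarrow> real) \<Rightarrow> 'a \<Rightarrow> real" where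
  "S_plus H T u0 = (THE \<psi>. \<exists>u. viscosity_solution H T u0 u \<and> \<psi> = (\<lambda>x. u (T, x)))"

definition reachable_set ::
  "('a::euclidean_space \<Rightarrow> real) \<Rightarrow> real \<Rightarrow> ('a \<Rightarrow> real) set" where
  "reachable_set H T = {\<psi> \<in> Lip. \<exists>u0 \<in> Lip. S_plus H T u0 = \<psi>}"

definition positive_definite :: "real^'n^'n \<Rightarrow> bool" where
  "positive_definite A \<longleftrightarrow> transpose A = A \<and> (\<forall>p. p \<noteq> 0 \<longrightarrow> (A *v p) \<bullet> p > 0)"

definition quadratic_hamiltonian :: "real^'n^'n \<Rightarrow> real^'n \<Rightarrow> real" where
  "quadratic_hamiltonian A p = ((A *v p) \<bullet> p) / 2"

(* The supremum is a maximum for Lipschitz \<phi> and positive definite A. *)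
definition u0_tilde :: "real^'n^'n \<Rightarrow> real \<Rightarrow> (real^'n \<Rightarrow> real) \<Rightarrow> real^'n \<Rightarrow> real" where
  "u0_tilde A T \<phi> x = (SUP y. \<phi> y - ((matrix_inv A *v (y - x)) \<bullet> (y - x)) / (2 * T))"

definition X_set :: "real^'n^'n \<Rightarrow> real \<Rightarrow> (real^'n \<Rightarrow> real) \<Rightarrow> (real^'n) set" where
  "X_set A T \<phi> = {z - T *\<^sub>R (A *v g) | z g. GDERIV \<phi> z :> g}"

(* support_on UNIV \<eta> is the set of points where \<eta> is nonzero, without taking the closure:
   X_set need not be open, and perturbations \<eta> positive arbitrarily close to a point
   of X_set at which they vanish are admissible. *)
definition I_set :: "real^'n^'n \<Rightarrow> real \<Rightarrow> (real^'n \<Rightarrow> real) \<Rightarrow> (real^'n \<Rightarrow> real) set" where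
  "I_set A T \<phi> =
     {(\<lambda>x. u0_tilde A T \<phi> x + \<eta> x) | \<eta>.
        \<eta> \<in> Lip \<and> (\<forall>x. \<eta> x \<ge> 0) \<and> support_on UNIV \<eta> \<subseteq> UNIV - X_set A T \<phi>}"

(* Stated pointwise: functions into the reals carry no real_vector instance,
   so convex_cone does not apply. *)
definition convex_cone_with_vertex :: "('a \<Rightarrow> real) \<Rightarrow> ('a \<Rightarrow> real) set \<Rightarrow> bool" where
  "convex_cone_with_vertex w C \<longleftrightarrow>
     w \<in> C \<and>
     (\<forall>f \<in> C. \<forall>g \<in> C. \<forall>a \<ge> 0. \<forall>b \<ge> 0. (\<lambda>x. w x + a * (f x - w x) + b * (g x - w x)) \<in> C)"

end

theory Submission
  imports Defs
begin

text \<open>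
  For a Lipschitz initial datum \<open>u\<^sub>0\<close> the viscosity solution is given by the Hopf--Lax formula, so the
  forward operator is \<open>Q u\<^sub>0 = inf\<^sub>y u\<^sub>0(y) + c(\<cdot> - y) / T\<close> with \<open>c(z) = (A\<^sup>-\<^sup>1 z \<bullet> z) / 2\<close>. Uniqueness needs no growth
  condition: \<open>c(x - y) / (t - s)\<close> is, in either pair of variables, an explicit smooth solution up to
  sign, and serves as test function.

  With \<open>P \<phi> = sup\<^sub>y \<phi>(y) - c(y - \<cdot>) / T\<close>, the reachable functions are the Lipschitz \<open>\<phi>\<close> touched from
  above at each point by a translate of \<open>c / T\<close>; for these \<open>Q (P \<phi>) = \<phi>\<close>. They form a convex set
  that is closed under minima. Hence the projection \<open>\<phi>\<close> of \<open>u\<^sub>T\<close> is unique, and comparison with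
  competitors shows that it has compact support; so \<open>P \<phi>\<close> is admissible and the minimisers are the
  admissible \<open>u\<close> with \<open>Q u = \<phi>\<close>. At a point \<open>z\<close> of differentiability of \<open>\<phi>\<close> the touching paraboloid is
  centred at \<open>z - T A \<nabla>\<phi>(z)\<close>, and such \<open>z\<close> are dense; so \<open>Q u = \<phi>\<close> holds iff \<open>u \<ge> P \<phi>\<close> with
  equality on \<open>X\<close>. Finally \<open>X\<close> contains a neighbourhood of infinity, so every such \<open>u\<close> has compact
  support.
\<close>

section \<open>The quadratic cost and its inf-convolution\<close>

lemma Lip_uminus: "f \<in> Lip \<Longrightarrow> (\<lambda>x. - f x :: real) \<in> Lip"
  by (auto simp: Lip_def lipschitz_on_def dist_real_def abs_minus_commute)

text \<open>\<open>B\<close> stands for the inverse matrix, whose quadratic form gives the transport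
  cost; the coercivity constant \<open>\<kappa>\<close> converts Lipschitz constants into bounds on
  the distance of minimisers.\<close>

locale quadratic_cost =
  fixes A B :: "'a::euclidean_space \<Rightarrow> 'a" and \<kappa> :: real
  assumes linear_B: "linear B"
    and B_sym: "B x \<bullet> y = x \<bullet> B y"
    and A_B: "A (B x) = x"
    and B_A: "B (A x) = x"
    and kappa_pos: "\<kappa> > 0"
    and coercive: "\<kappa> * (norm z)\<^sup>2 \<le> (B z \<bullet> z) / 2"
begin

text \<open>The Legendre transform of \<open>H\<close>. Travelling by \<open>z\<close> in time
  \<open>t\<close> at constant velocity costs
  \<open>t * c (z /\<^sub>R t) = c z / t\<close>.\<close>

definition c :: "'a \<Rightarrow> real" where
  "c z = (B z \<bullet> z) / 2"

definition H :: "'a \<Rightarrow> real" where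
  "H p = (A p \<bullet> p) / 2"

lemma c_ge: "\<kappa> * (norm z)\<^sup>2 \<le> c z"
  using coercive by (simp add: c_def)

lemma c_nonneg [simp]: "0 \<le> c z"
  using c_ge[of z] kappa_pos by (meson mult_nonneg_nonneg order_trans less_imp_le zero_le_power2)

lemma c_add: "c (x + y) = c x + B x \<bullet> y + c y"
  using B_sym[of x y]
  by (simp add: c_def linear_add[OF linear_B] inner_add_left inner_add_right inner_commute field_simps)

lemma c_scaleR: "c (r *\<^sub>R x) = r\<^sup>2 * c x"
  by (simp add: c_def linear_scale[OF linear_B] power2_eq_square)

lemma c_zero [simp]: "c 0 = 0"
  by (simp add: c_def)

lemma c_minus [simp]: "c (- x) = c x"
  using c_scaleR[of "-1" x] by simp

lemma c_minus_commute: "c (x - y) = c (y - x)"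
  using c_minus[of "x - y"] by simp

lemma H_B: "H (B z) = c z"
  by (simp add: H_def c_def A_B inner_commute)

text \<open>With \<open>r = 1 / t\<close> this is the equation for \<open>c x / t\<close>, whose
  gradient is \<open>B x /\<^sub>R t\<close> and whose time derivative is
  \<open>- c x / t\<^sup>2\<close>.\<close>

lemma H_scaleR_B: "H (r *\<^sub>R B z) = r\<^sup>2 * c z"
  by (metis H_B c_scaleR linear_B linear_scale)

lemma continuous_B: "continuous_on S B"
  using linear_B by (intro linear_continuous_on) (simp add: linear_conv_bounded_linear)

lemma continuous_on_c [continuous_intros]: "continuous_on S f \<Longrightarrow> continuous_on S (\<lambda>x. c (f x))"
  unfolding c_def by (intro continuous_intros continuous_on_compose2[OF continuous_B[of UNIV]]) auto


text \<open>Constant velocity is cheapest: the defect is a positive multiple of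
  \<open>c (t *\<^sub>R x - s *\<^sub>R y)\<close>.\<close>

lemma c_triangle:
  assumes "s > 0" "t > 0"
  shows "c (x + y) / (s + t) \<le> c x / s + c y / t"
proof -
  have "c (t *\<^sub>R x - s *\<^sub>R y) = t\<^sup>2 * c x - s * t * (B x \<bullet> y) + s\<^sup>2 * c y"
    using c_add[of "t *\<^sub>R x" "(- s) *\<^sub>R y"] c_scaleR[of t x] c_scaleR[of "-s" y]
    by (simp add: linear_scale[OF linear_B] algebra_simps)
  then have "0 \<le> t\<^sup>2 * c x - s * t * (B x \<bullet> y) + s\<^sup>2 * c y"
    by (metis c_nonneg)
  then have "s * t * c (x + y) \<le> (s + t) * (t * c x + s * c y)"
    unfolding c_add by (simp add: power2_eq_square algebra_simps)
  then show ?thesis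
    using assms by (simp add: field_simps)
qed

text \<open>Completing the square: the cost over time \<open>t\<close> absorbs linear growth up to
  an error of order \<open>t\<close>.\<close>

lemma young:
  assumes "t > 0"
  shows "L * norm z \<le> c z / t + L\<^sup>2 * t / (4 * \<kappa>)"
proof -
  have "0 \<le> (2 * \<kappa> * norm z - L * t)\<^sup>2 / (4 * \<kappa> * t)"
    using assms kappa_pos by simp
  also have "\<dots> = \<kappa> * (norm z)\<^sup>2 / t - L * norm z + L\<^sup>2 * t / (4 * \<kappa>)"
    using assms kappa_pos by (simp add: field_simps power2_eq_square)
  finally show ?thesis
    using divide_right_mono[OF c_ge[of z], of t] assms by simp
qed

definition Q :: "real \<Rightarrow> ('a \<Rightarrow> real) \<Rightarrow> 'a \<Rightarrow> real" where
  "Q t f x = (INF y. f y + c (x - y) / t)"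

text \<open>The sup-convolution, that is, the backward evolution. It is expressed by
  \<open>Q\<close> so that bounds on \<open>Q\<close> carry over by a change of sign.\<close>

definition P :: "real \<Rightarrow> ('a \<Rightarrow> real) \<Rightarrow> 'a \<Rightarrow> real" where
  "P t f x = - Q t (\<lambda>y. - f y) x"

lemma Q_eqI:
  assumes "f y + c (x - y) / t = a" "\<And>z. a \<le> f z + c (x - z) / t"
  shows "Q t f x = a"
  unfolding Q_def using assms by (intro cInf_eq_minimum) auto

lemma lipschitz_real_le:
  assumes "L-lipschitz_on UNIV (f :: 'a \<Rightarrow> real)"
  shows "f x \<le> f y + L * norm (x - y)"
  using lipschitz_onD[OF assms, of x y] by (simp add: dist_norm abs_le_iff)

text \<open>Beyond distance \<open>L * t / \<kappa>\<close> the cost exceeds the largest possible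
  gain \<open>L * norm (x - z)\<close> over staying at \<open>x\<close>, so a minimum over a compact
  ball is global.\<close>

lemma Q_minimizer:
  assumes "L-lipschitz_on UNIV f" "t > 0"
  obtains y where "norm (x - y) \<le> L * t / \<kappa>" "\<And>z. f y + c (x - y) / t \<le> f z + c (x - z) / t"
proof -
  define r where "r = L * t / \<kappa>"
  have L: "L \<ge> 0" using assms(1) by (rule lipschitz_on_nonneg)
  have r: "r \<ge> 0" using L assms(2) kappa_pos by (simp add: r_def)
  have "continuous_on (cball x r) (\<lambda>y. f y + c (x - y) / t)"
    using assms lipschitz_on_continuous_on[OF assms(1)]
    by (intro continuous_intros) (auto intro: continuous_on_subset)
  then obtain y where y: "y \<in> cball x r" "\<And>z. z \<in> cball x r \<Longrightarrow> f y + c (x - y) / t \<le> f z + c (x - z) / t"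
    using continuous_attains_inf[of "cball x r"] r by fastforce
  have "f y + c (x - y) / t \<le> f z + c (x - z) / t" for z
  proof (cases "z \<in> cball x r")
    case False
    then have "norm (x - z) \<ge> r" by (simp add: dist_norm)
    then have "L * norm (x - z) \<le> \<kappa> * (norm (x - z))\<^sup>2 / t"
      using assms(2) kappa_pos mult_right_mono[of "L * t" "\<kappa> * norm (x - z)" "norm (x - z)"]
      by (simp add: r_def field_simps power2_eq_square)
    also have "\<dots> \<le> c (x - z) / t"
      using assms(2) by (intro divide_right_mono c_ge) auto
    finally have "f x \<le> f z + c (x - z) / t"
      using lipschitz_real_le[OF assms(1), of x z] by simp
    moreover have "f y + c (x - y) / t \<le> f x"
      using y(2)[of x] r by simp
    ultimately show ?thesis by simp
  qed (rule y(2))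
  then show ?thesis
    using that y(1) by (simp add: dist_norm r_def)
qed

lemma Q_attained:
  assumes "L-lipschitz_on UNIV f" "t > 0"
  obtains y where "norm (x - y) \<le> L * t / \<kappa>" "Q t f x = f y + c (x - y) / t"
  by (metis Q_minimizer[OF assms] Q_eqI)

lemma Q_le:
  assumes "L-lipschitz_on UNIV f" "t > 0"
  shows "Q t f x \<le> f y + c (x - y) / t"
proof -
  obtain z where z: "\<And>w. f z + c (x - z) / t \<le> f w + c (x - w) / t"
    using Q_minimizer[OF assms] by metis
  then have "Q t f x = f z + c (x - z) / t"
    by (intro Q_eqI) auto
  with z show ?thesis by simp
qed

text \<open>Shifting the minimiser along with \<open>x\<close> leaves the cost unchanged, so only
  the variation of \<open>f\<close> counts.\<close>

lemma Q_lipschitz: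
  assumes "L-lipschitz_on UNIV f" "t > 0"
  shows "L-lipschitz_on UNIV (Q t f)"
proof (rule lipschitz_onI)
  have *: "Q t f x' \<le> Q t f x + L * dist x x'" for x x'
  proof -
    obtain y where "Q t f x = f y + c (x - y) / t"
      using Q_attained[OF assms] by metis
    moreover have "Q t f x' \<le> f (y + x' - x) + c (x' - (y + x' - x)) / t"
      by (rule Q_le[OF assms])
    moreover have "f (y + x' - x) \<le> f y + L * dist x x'"
      using lipschitz_real_le[OF assms(1), of "y + x' - x" y]
      by (simp add: dist_norm norm_minus_commute)
    ultimately show ?thesis by (simp add: algebra_simps)
  qed
  show "dist (Q t f x) (Q t f y) \<le> L * dist x y" for x y
    using *[of x y] *[of y x] by (simp add: dist_real_def abs_le_iff dist_commute)
qed (rule lipschitz_on_nonneg[OF assms(1)])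

lemma Lip_Q: "f \<in> Lip \<Longrightarrow> t > 0 \<Longrightarrow> Q t f \<in> Lip"
  unfolding Lip_def using Q_lipschitz by blast

lemma Lip_P: "f \<in> Lip \<Longrightarrow> t > 0 \<Longrightarrow> P t f \<in> Lip"
  unfolding P_def[abs_def] by (intro Lip_uminus Lip_Q)


section \<open>Uniqueness of viscosity solutions\<close>

lemma has_derivative_c: "((\<lambda>x. c (x - y)) has_derivative (\<lambda>h. B (x - y) \<bullet> h)) (at x)"
proof -
  have dB: "(B has_derivative B) (at z)" for z
    using linear_B by (intro bounded_linear_imp_has_derivative) (simp add: linear_conv_bounded_linear)
  have d3: "((\<lambda>x. x - y) has_derivative (\<lambda>h. h)) (at x)"
    by (auto intro!: derivative_eq_intros)
  have d4: "((\<lambda>x. B (x - y)) has_derivative (\<lambda>h. B h)) (at x)"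
    using has_derivative_compose[OF d3 dB] .
  show ?thesis
    unfolding c_def
    by (rule derivative_eq_intros d3 d4 | simp)+ (auto simp: B_sym inner_commute)
qed

text \<open>Here \<open>m\<close> will replace \<open>1 / (t - s)\<close> up to sign, and
  \<open>k\<close> is a penalty in time.\<close>

lemma C1_test_quadratic:
  assumes m: "\<And>t. (m has_real_derivative m' t) (at t)" "continuous_on UNIV m'"
    and k: "\<And>t. (k has_real_derivative k' t) (at t)" "continuous_on UNIV k'"
  shows "C1_test_function T (\<lambda>z. c (snd z - y) * m (fst z) + k (fst z))
    (\<lambda>z. (c (snd z - y) * m' (fst z) + k' (fst z), m (fst z) *\<^sub>R B (snd z - y)))"
proof -
  have cm: "continuous_on UNIV m"
    using m(1) DERIV_isCont continuous_at_imp_continuous_on by blast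
  have "((\<lambda>z. c (snd z - y) * m (fst z) + k (fst z)) has_derivative
      (\<lambda>h. c (snd z - y) * (m' (fst z) * fst h) + (B (snd z - y) \<bullet> snd h) * m (fst z) + k' (fst z) * fst h)) (at z)" for z :: "real \<times> 'a"
  proof -
    have d1: "((\<lambda>z::real\<times>'a. m (fst z)) has_derivative (\<lambda>h. m' (fst z) * fst h)) (at z)"
      using has_derivative_compose[OF has_derivative_fst[OF has_derivative_ident] m(1)[unfolded has_field_derivative_def]] .
    have d2: "((\<lambda>z::real\<times>'a. k (fst z)) has_derivative (\<lambda>h. k' (fst z) * fst h)) (at z)"
      using has_derivative_compose[OF has_derivative_fst[OF has_derivative_ident] k(1)[unfolded has_field_derivative_def]] .
    have d5: "((\<lambda>z::real\<times>'a. c (snd z - y)) has_derivative (\<lambda>h. B (snd z - y) \<bullet> snd h)) (at z)"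
      using has_derivative_compose[OF has_derivative_snd[OF has_derivative_ident] has_derivative_c] .
    show ?thesis
      by (rule derivative_eq_intros d1 d2 d5 | simp)+
  qed
  then show ?thesis
    unfolding C1_test_function_def gderiv_def
    by (auto simp: inner_prod_def inner_commute algebra_simps intro!: continuous_intros
       continuous_on_compose2[OF continuous_B[of UNIV]] continuous_on_compose2[OF m(2)]
       continuous_on_compose2[OF k(2)] continuous_on_compose2[OF cm])
qed

text \<open>Replaces \<open>1 / \<tau>\<close> in test functions, which must be smooth on the whole strip.\<close>

definition recip_major :: "real \<Rightarrow> real \<Rightarrow> real" where
  "recip_major \<tau>\<^sub>0 \<tau> = 1 / \<tau>\<^sub>0 - (\<tau> - \<tau>\<^sub>0) / \<tau>\<^sub>0\<^sup>2 + 2 / \<tau>\<^sub>0 ^ 3 * (\<tau> - \<tau>\<^sub>0)\<^sup>2"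

lemma recip_major_same [simp]: "recip_major \<tau>\<^sub>0 \<tau>\<^sub>0 = 1 / \<tau>\<^sub>0"
  by (simp add: recip_major_def)

text \<open>\<open>recip_major\<close> is the second-order Taylor polynomial of
  \<open>1 / \<tau>\<close> with its quadratic coefficient doubled; the difference is then a
  positive multiple of a square times \<open>2 * \<tau> - \<tau>\<^sub>0\<close>. Value and slope at
  \<open>\<tau>\<^sub>0\<close> are kept, so contact points and gradients survive the
  replacement.\<close>

lemma recip_le_recip_major:
  assumes "\<tau>\<^sub>0 > 0" "\<tau> > \<tau>\<^sub>0 / 2"
  shows "1 / \<tau> \<le> recip_major \<tau>\<^sub>0 \<tau>"
proof -
  have "\<tau> > 0" using assms by simp
  then have "recip_major \<tau>\<^sub>0 \<tau> - 1 / \<tau> = (\<tau> - \<tau>\<^sub>0)\<^sup>2 * (2 * \<tau> - \<tau>\<^sub>0) / (\<tau> * \<tau>\<^sub>0 ^ 3)"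
    using assms by (simp add: recip_major_def field_simps power2_eq_square power3_eq_cube)
  also have "\<dots> \<ge> 0"
    using assms \<open>\<tau> > 0\<close> by (intro divide_nonneg_nonneg mult_nonneg_nonneg) auto
  finally show ?thesis by simp
qed

lemma recip_major_deriv:
  "(recip_major \<tau>\<^sub>0 has_real_derivative (- 1 / \<tau>\<^sub>0\<^sup>2 + 4 / \<tau>\<^sub>0 ^ 3 * (\<tau> - \<tau>\<^sub>0))) (at \<tau>)"
proof -
  have "((\<lambda>\<tau>. a - (\<tau> - \<tau>\<^sub>0) * b + d * (\<tau> - \<tau>\<^sub>0)\<^sup>2) has_real_derivative (- b + 2 * d * (\<tau> - \<tau>\<^sub>0))) (at \<tau>)"
    for a b d :: real
    by (auto intro!: derivative_eq_intros)
  from this[of "1 / \<tau>\<^sub>0" "1 / \<tau>\<^sub>0\<^sup>2" "2 / \<tau>\<^sub>0 ^ 3"] show ?thesis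
    by (simp add: recip_major_def[abs_def])
qed

text \<open>The cost solves the equation exactly after time \<open>s\<close>, so its contributions
  cancel in the viscosity inequality and only the slope of \<open>k\<close> is left. A strictly
  increasing \<open>k\<close> therefore excludes such a maximum.\<close>

lemma subsolution_contact:
  fixes u :: "real \<times> 'a \<Rightarrow> real"
  assumes sub: "viscosity_subsolution H T u"
    and t0: "0 \<le> s" "s < t\<^sub>0" "t\<^sub>0 < T"
    and k: "\<And>t. (k has_real_derivative k' t) (at t)" "continuous_on UNIV k'"
    and max: "\<forall>\<^sub>F z in nhds (t\<^sub>0, x\<^sub>0). u z - c (snd z - y) / (fst z - s) - k (fst z)
      \<le> u (t\<^sub>0, x\<^sub>0) - c (x\<^sub>0 - y) / (t\<^sub>0 - s) - k t\<^sub>0"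
  shows "k' t\<^sub>0 \<le> 0"
proof -
  define \<tau> where "\<tau> = t\<^sub>0 - s"
  have \<tau>: "\<tau> > 0" using t0 by (simp add: \<tau>_def)
  define m where "m t = recip_major \<tau> (t - s)" for t
  define m' where "m' t = - 1 / \<tau>\<^sup>2 + 4 / \<tau> ^ 3 * (t - s - \<tau>)" for t
  have m: "(m has_real_derivative m' t) (at t)" for t
    unfolding m_def m'_def
    using DERIV_shift[of "recip_major \<tau>" "- 1 / \<tau>\<^sup>2 + 4 / \<tau> ^ 3 * (t - s - \<tau>)" t "-s"] recip_major_deriv[of \<tau> "t - s"]
    by simp
  have m'_cont: "continuous_on UNIV m'"
    unfolding m'_def by (intro continuous_intros)
  define v where "v z = c (snd z - y) * m (fst z) + k (fst z)" for z :: "real \<times> 'a"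
  have "open {z :: real \<times> 'a. fst z - s > \<tau> / 2}"
    by (intro open_Collect_less continuous_intros)
  then have "\<forall>\<^sub>F z :: real \<times> 'a in nhds (t\<^sub>0, x\<^sub>0). fst z - s > \<tau> / 2"
    using \<tau> eventually_nhds_in_open[of "{z :: real \<times> 'a. fst z - s > \<tau> / 2}" "(t\<^sub>0, x\<^sub>0)"]
    by (simp add: \<tau>_def)
  with max have "\<forall>\<^sub>F z in nhds (t\<^sub>0, x\<^sub>0). u z - v z \<le> u (t\<^sub>0, x\<^sub>0) - v (t\<^sub>0, x\<^sub>0)"
  proof eventually_elim
    case (elim z)
    have "c (snd z - y) / (fst z - s) \<le> c (snd z - y) * m (fst z)"
      using mult_left_mono[OF recip_le_recip_major[OF \<tau> elim(2)], of "c (snd z - y)"] by (simp add: m_def)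
    then show ?case
      using elim(1) by (simp add: v_def m_def \<tau>_def)
  qed
  then have "fst (c (x\<^sub>0 - y) * m' t\<^sub>0 + k' t\<^sub>0, m t\<^sub>0 *\<^sub>R B (x\<^sub>0 - y))
      + H (snd (c (x\<^sub>0 - y) * m' t\<^sub>0 + k' t\<^sub>0, m t\<^sub>0 *\<^sub>R B (x\<^sub>0 - y))) \<le> 0"
    using sub t0 C1_test_quadratic[OF m m'_cont k, of T y]
    unfolding viscosity_subsolution_def v_def by fastforce
  then show ?thesis
    using \<tau> by (simp add: H_scaleR_B m_def m'_def \<tau>_def[symmetric] power_divide)
qed

text \<open>As a function of the starting point, minus the cost is again an exact solution before
  time \<open>t\<close>, and the same cancellation occurs.\<close>

lemma supersolution_contact:
  fixes u :: "real \<times> 'a \<Rightarrow> real"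
  assumes sup: "viscosity_supersolution H T u"
    and s0: "0 < s\<^sub>0" "s\<^sub>0 < t" "t \<le> T"
    and k: "\<And>t. (k has_real_derivative k' t) (at t)" "continuous_on UNIV k'"
    and min: "\<forall>\<^sub>F z in nhds (s\<^sub>0, y\<^sub>0). u z + c (x - snd z) / (t - fst z) + k (fst z)
      \<ge> u (s\<^sub>0, y\<^sub>0) + c (x - y\<^sub>0) / (t - s\<^sub>0) + k s\<^sub>0"
  shows "k' s\<^sub>0 \<le> 0"
proof -
  define \<tau> where "\<tau> = t - s\<^sub>0"
  have \<tau>: "\<tau> > 0" using s0 by (simp add: \<tau>_def)
  define m where "m s = - recip_major \<tau> (t - s)" for s
  define m' where "m' s = - 1 / \<tau>\<^sup>2 + 4 / \<tau> ^ 3 * (t - s - \<tau>)" for s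
  have m: "(m has_real_derivative m' s) (at s)" for s
    unfolding m_def m'_def
    by (rule derivative_eq_intros DERIV_chain2[OF recip_major_deriv] | simp)+
  have m'_cont: "continuous_on UNIV m'"
    unfolding m'_def by (intro continuous_intros)
  have k': "((\<lambda>t. - k t) has_real_derivative - k' t) (at t)" for t
    using k(1) by (rule DERIV_minus)
  have k'_cont: "continuous_on UNIV (\<lambda>t. - k' t)"
    using k(2) by (rule continuous_on_minus)
  define v where "v z = c (snd z - x) * m (fst z) + - k (fst z)" for z :: "real \<times> 'a"
  have "open {z :: real \<times> 'a. t - fst z > \<tau> / 2}"
    by (intro open_Collect_less continuous_intros)
  then have "\<forall>\<^sub>F z :: real \<times> 'a in nhds (s\<^sub>0, y\<^sub>0). t - fst z > \<tau> / 2"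
    using \<tau> eventually_nhds_in_open[of "{z :: real \<times> 'a. t - fst z > \<tau> / 2}" "(s\<^sub>0, y\<^sub>0)"]
    by (simp add: \<tau>_def)
  with min have "\<forall>\<^sub>F z in nhds (s\<^sub>0, y\<^sub>0). u z - v z \<ge> u (s\<^sub>0, y\<^sub>0) - v (s\<^sub>0, y\<^sub>0)"
  proof eventually_elim
    case (elim z)
    have "c (x - snd z) / (t - fst z) \<le> - c (snd z - x) * m (fst z)"
      using mult_left_mono[OF recip_le_recip_major[OF \<tau> elim(2)], of "c (snd z - x)"]
      by (simp add: m_def c_minus_commute)
    then show ?case
      using elim(1) by (simp add: v_def m_def \<tau>_def c_minus_commute)
  qed
  then have "fst (c (y\<^sub>0 - x) * m' s\<^sub>0 + - k' s\<^sub>0, m s\<^sub>0 *\<^sub>R B (y\<^sub>0 - x))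
      + H (snd (c (y\<^sub>0 - x) * m' s\<^sub>0 + - k' s\<^sub>0, m s\<^sub>0 *\<^sub>R B (y\<^sub>0 - x))) \<ge> 0"
    using sup s0 C1_test_quadratic[OF m m'_cont k' k'_cont, of T x]
    unfolding viscosity_supersolution_def v_def by fastforce
  then show ?thesis
    using \<tau> H_scaleR_B[of "- (1 / \<tau>)" "y\<^sub>0 - x"]
    by (simp add: m_def m'_def \<tau>_def[symmetric] power_divide)
qed


section \<open>Comparison over a short time step\<close>

text \<open>The penalty is small at \<open>t\<^sub>1\<close>, so that a violation there survives,
  and large at \<open>t\<^sub>2\<close>, so that no extremum lies there. The rate comes from
  \<open>exp x \<ge> 1 + x\<close>.\<close>

lemma exp_penalty:
  assumes "\<epsilon> > 0" "t\<^sub>1 < t\<^sub>2" "C > 0"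
  obtains k k' :: "real \<Rightarrow> real" where "\<And>t. (k has_real_derivative k' t) (at t)" "continuous_on UNIV k'"
    "\<And>t. k' t > 0" "\<And>t. k t > 0" "k t\<^sub>1 = \<epsilon>" "k t\<^sub>2 \<ge> C"
proof -
  define \<Lambda> where "\<Lambda> = C / \<epsilon> / (t\<^sub>2 - t\<^sub>1)"
  have \<Lambda>: "\<Lambda> > 0" using assms by (simp add: \<Lambda>_def)
  have "C / \<epsilon> \<le> exp (\<Lambda> * (t\<^sub>2 - t\<^sub>1))"
    using order_trans[OF _ exp_ge_add_one_self, of "C / \<epsilon>" "C / \<epsilon>"] assms by (simp add: \<Lambda>_def)
  then have "C \<le> \<epsilon> * exp (\<Lambda> * (t\<^sub>2 - t\<^sub>1))"
    using assms by (simp add: field_simps)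
  moreover have "((\<lambda>t. \<epsilon> * exp (\<Lambda> * (t - t\<^sub>1))) has_real_derivative \<epsilon> * \<Lambda> * exp (\<Lambda> * (t - t\<^sub>1))) (at t)" for t
    by (auto intro!: derivative_eq_intros)
  moreover have "continuous_on UNIV (\<lambda>t. \<epsilon> * \<Lambda> * exp (\<Lambda> * (t - t\<^sub>1)))"
    by (intro continuous_intros)
  ultimately show ?thesis
    using that[of "\<lambda>t. \<epsilon> * exp (\<Lambda> * (t - t\<^sub>1))" "\<lambda>t. \<epsilon> * \<Lambda> * exp (\<Lambda> * (t - t\<^sub>1))"] assms \<Lambda> by simp
qed

text \<open>If the inequality fails by \<open>\<delta>\<close>, then \<open>u\<close> minus cost
  minus penalty has an interior maximum in a cylinder: the penalty excludes the top, coercivity the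
  lateral boundary, continuity at \<open>(s, y)\<close> the bottom. This contradicts
  \<open>subsolution_contact\<close>.\<close>

lemma subsolution_local:
  fixes u :: "real \<times> 'a \<Rightarrow> real"
  assumes cont: "continuous_on ({0..T} \<times> UNIV) u" and sub: "viscosity_subsolution H T u"
    and t: "0 \<le> s" "s < t\<^sub>1" "t\<^sub>1 < T"
    and M: "\<And>t x. t \<in> {0..T} \<Longrightarrow> x \<in> cball y 1 \<Longrightarrow> \<bar>u (t, x)\<bar> \<le> M"
    and near: "norm (x\<^sub>1 - y) < 1" "(t\<^sub>1 - s) * (2 * M + 1) < \<kappa>"
  shows "u (t\<^sub>1, x\<^sub>1) \<le> u (s, y) + c (x\<^sub>1 - y) / (t\<^sub>1 - s)"
proof (rule ccontr)
  assume neg: "\<not> ?thesis"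
  define \<delta> where "\<delta> = u (t\<^sub>1, x\<^sub>1) - u (s, y) - c (x\<^sub>1 - y) / (t\<^sub>1 - s)"
  have \<delta>: "\<delta> > 0" using neg by (simp add: \<delta>_def)
  have M0: "M \<ge> 0" using M[of s y] t by fastforce
  define N where "N = 2 * M + 1"
  have N: "N > 0" using M0 by (simp add: N_def)
  \<comment> \<open>The cylinder must reach beyond \<open>t\<^sub>1\<close>, yet end early enough
    that the cost at distance \<open>1\<close> still exceeds \<open>N\<close>.\<close>
  have "t\<^sub>1 < min T (s + \<kappa> / N)"
    using t near(2)[folded N_def] N by (simp add: field_simps)
  then obtain t\<^sub>2 where t2: "t\<^sub>1 < t\<^sub>2" "t\<^sub>2 < T" "t\<^sub>2 < s + \<kappa> / N"
    by (meson dense min_less_iff_conj)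
  obtain k k' where k: "\<And>t. (k has_real_derivative k' t) (at t)" "continuous_on UNIV k'"
    and k': "\<And>t. k' t > (0::real)" and kpos: "\<And>t. k t > 0" and kt: "k t\<^sub>1 = \<delta> / 2" "k t\<^sub>2 \<ge> N"
    using exp_penalty[of "\<delta> / 2" t\<^sub>1 t\<^sub>2 N] \<delta> t2 N by auto
  define \<Phi> where "\<Phi> z = u z - c (snd z - y) / (fst z - s) - k (fst z)" for z
  have \<Phi>1: "\<Phi> (t\<^sub>1, x\<^sub>1) = u (s, y) + \<delta> / 2"
    by (simp add: \<Phi>_def kt \<delta>_def field_simps)
  have "(s, y) \<in> {0..T} \<times> UNIV" using t by simp
  then obtain \<rho> where \<rho>: "\<rho> > 0"
    "\<And>z. z \<in> {0..T} \<times> UNIV \<Longrightarrow> dist z (s, y) < \<rho> \<Longrightarrow> dist (u z) (u (s, y)) < \<delta> / 2"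
    using cont \<delta> unfolding continuous_on_iff by (metis half_gt_zero)
  define r where "r = \<rho> / 2"
  \<comment> \<open>The cylinder starts after \<open>s\<close>, where the cost is singular. The
    three bounds keep the bottom within reach of the continuity estimate, keep
    \<open>t\<^sub>1\<close> above it, and make the cost at least \<open>N\<close> at spatial
    distance \<open>r\<close> or more.\<close>
  define \<eta> where "\<eta> = min (\<rho> / 2) (min ((t\<^sub>1 - s) / 2) (\<kappa> * r\<^sup>2 / N))"
  have r: "r > 0" using \<rho> by (simp add: r_def)
  have \<eta>: "\<eta> > 0" "\<eta> \<le> \<rho> / 2" "\<eta> \<le> (t\<^sub>1 - s) / 2" "\<eta> \<le> \<kappa> * r\<^sup>2 / N"
    using \<rho> r N kappa_pos t unfolding \<eta>_def
    by (auto intro: min.coboundedI1 min.coboundedI2 simp del: le_divide_eq_numeral1)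
  define S where "S = {s + \<eta>..t\<^sub>2} \<times> cball y 1"
  have "continuous_on S \<Phi>"
    unfolding \<Phi>_def S_def using \<eta>(1) t t2
    by (intro continuous_intros continuous_on_subset[OF cont]
        continuous_on_compose2[OF DERIV_continuous_on[OF k(1)]])
      (auto intro: DERIV_subset[OF k(1)])
  moreover have S1: "(t\<^sub>1, x\<^sub>1) \<in> S"
    using near t2 \<eta> t by (auto simp: S_def dist_norm norm_minus_commute)
  moreover have "compact S"
    by (simp add: S_def compact_Times)
  ultimately obtain t\<^sub>0 x\<^sub>0 where z0: "(t\<^sub>0, x\<^sub>0) \<in> S" and max: "\<And>z. z \<in> S \<Longrightarrow> \<Phi> z \<le> \<Phi> (t\<^sub>0, x\<^sub>0)"
    using continuous_attains_sup[of S \<Phi>] by (metis empty_iff surj_pair)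
  have ge: "u (s, y) + \<delta> / 2 \<le> \<Phi> (t\<^sub>0, x\<^sub>0)"
    using max[OF S1] \<Phi>1 by simp
  have in0: "s + \<eta> \<le> t\<^sub>0" "t\<^sub>0 \<le> t\<^sub>2" "dist y x\<^sub>0 \<le> 1"
    using z0 by (auto simp: S_def)
  have u0: "u (t\<^sub>0, x\<^sub>0) \<le> M" "- M \<le> u (s, y)"
    using M[of t\<^sub>0 x\<^sub>0] M[of s y] in0 \<eta> t t2 by (auto simp: abs_le_iff)
  have c0: "0 \<le> c (x\<^sub>0 - y) / (t\<^sub>0 - s)"
    using in0 \<eta> by simp
  have less: "c (x\<^sub>0 - y) / (t\<^sub>0 - s) < N"
    using ge u0 kpos[of t\<^sub>0] \<delta> by (simp add: \<Phi>_def N_def)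
  have "t\<^sub>0 \<noteq> t\<^sub>2"
    using ge u0 kt(2) c0 \<delta> by (auto simp: \<Phi>_def N_def)
  moreover have "dist y x\<^sub>0 \<noteq> 1"
  proof
    assume "dist y x\<^sub>0 = 1"
    then have far: "\<kappa> \<le> c (x\<^sub>0 - y)"
      using c_ge[of "x\<^sub>0 - y"] by (simp add: dist_norm norm_minus_commute)
    have "N * (t\<^sub>0 - s) \<le> N * (t\<^sub>2 - s)"
      using in0 N by (intro mult_left_mono) auto
    moreover have "N * (t\<^sub>2 - s) < \<kappa>"
      using t2(3) N by (simp add: field_simps)
    ultimately have "N * (t\<^sub>0 - s) < \<kappa>"
      by linarith
    then show False
      using far less in0 \<eta> by (simp add: field_simps)
  qed
  \<comment> \<open>At the bottom, a point close to \<open>(s, y)\<close> has too small a value of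
    \<open>u\<close>, and a point at distance at least \<open>r\<close> has too large a
    cost.\<close>
  moreover have "t\<^sub>0 \<noteq> s + \<eta>"
  proof
    assume t0: "t\<^sub>0 = s + \<eta>"
    have "u (t\<^sub>0, x\<^sub>0) \<ge> u (s, y) + \<delta> / 2"
      using ge c0 kpos[of t\<^sub>0] by (simp add: \<Phi>_def)
    then have "\<not> dist (t\<^sub>0, x\<^sub>0) (s, y) < \<rho>"
      using \<rho>(2)[of "(t\<^sub>0, x\<^sub>0)"] in0 \<eta> t t2 by (auto simp: dist_real_def abs_real_def split: if_splits)
    moreover have "dist (t\<^sub>0, x\<^sub>0) (s, y) \<le> \<eta> + dist x\<^sub>0 y"
      using t0 \<eta>(1) sqrt_sum_squares_le_sum_abs[of "\<eta>" "dist x\<^sub>0 y"] by (simp add: dist_Pair_Pair dist_real_def)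
    ultimately have "norm (x\<^sub>0 - y) \<ge> r"
      using \<eta> by (simp add: r_def dist_norm)
    then have "\<kappa> * r\<^sup>2 \<le> c (x\<^sub>0 - y)"
      using c_ge[of "x\<^sub>0 - y"] power_mono[of r "norm (x\<^sub>0 - y)" 2] r kappa_pos
      by (meson mult_left_mono less_imp_le order_trans)
    then have "N * \<eta> \<le> c (x\<^sub>0 - y)"
      using \<eta>(4) N by (simp add: field_simps)
    then show False
      using less t0 \<eta>(1) by (simp add: field_simps)
  qed
  ultimately have "(t\<^sub>0, x\<^sub>0) \<in> {s + \<eta><..<t\<^sub>2} \<times> ball y 1"
    using in0 by simp
  then have "\<forall>\<^sub>F z in nhds (t\<^sub>0, x\<^sub>0). z \<in> {s + \<eta><..<t\<^sub>2} \<times> ball y 1"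
    by (intro eventually_nhds_in_open open_Times) auto
  then have ev: "\<forall>\<^sub>F z in nhds (t\<^sub>0, x\<^sub>0). \<Phi> z \<le> \<Phi> (t\<^sub>0, x\<^sub>0)"
    by eventually_elim (auto intro!: max simp: S_def)
  have "k' t\<^sub>0 \<le> 0"
    using ev in0 \<eta> t t2 unfolding \<Phi>_def
    by (intro subsolution_contact[OF sub t(1) _ _ k, of t\<^sub>0 y x\<^sub>0]) auto
  with k'[of t\<^sub>0] show False by simp
qed

text \<open>If every \<open>y\<close> fails, the minimum of \<open>u\<close> plus cost plus penalty
  is interior: at time \<open>s\<^sub>1\<close> all values exceed
  \<open>u (t, x) + \<delta>\<close>, while a point just before \<open>(t, x)\<close> has a smaller
  value. Penalty and coercivity exclude the other faces, and \<open>supersolution_contact\<close>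
  applies.\<close>

lemma supersolution_local:
  fixes u :: "real \<times> 'a \<Rightarrow> real"
  assumes cont: "continuous_on ({0..T} \<times> UNIV) u" and sup: "viscosity_supersolution H T u"
    and t: "0 \<le> s\<^sub>1" "s\<^sub>1 < t" "t \<le> T"
    and M: "\<And>t y. t \<in> {0..T} \<Longrightarrow> y \<in> cball x 1 \<Longrightarrow> \<bar>u (t, y)\<bar> \<le> M"
    and near: "(t - s\<^sub>1) * (2 * M + 1) < \<kappa>"
  shows "\<exists>y. u (s\<^sub>1, y) + c (x - y) / (t - s\<^sub>1) \<le> u (t, x)"
proof (rule ccontr)
  assume neg: "\<not> ?thesis"
  have M0: "M \<ge> 0" using M[of s\<^sub>1 x] t by fastforce
  define N where "N = 2 * M + 1"
  have N: "N > 0" using M0 by (simp add: N_def)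
  have "continuous_on (cball x 1) (\<lambda>y. u (s\<^sub>1, y) + c (x - y) / (t - s\<^sub>1))"
    using t by (intro continuous_intros continuous_on_compose2[OF cont]) auto
  then obtain y\<^sub>1 where y1: "y\<^sub>1 \<in> cball x 1"
    "\<And>y. y \<in> cball x 1 \<Longrightarrow> u (s\<^sub>1, y\<^sub>1) + c (x - y\<^sub>1) / (t - s\<^sub>1) \<le> u (s\<^sub>1, y) + c (x - y) / (t - s\<^sub>1)"
    using continuous_attains_inf[of "cball x 1"] by fastforce
  \<comment> \<open>The cap at \<open>1\<close> lets the summand \<open>1\<close> in
    \<open>N\<close> absorb \<open>\<delta>\<close>.\<close>
  define \<delta> where "\<delta> = min 1 (u (s\<^sub>1, y\<^sub>1) + c (x - y\<^sub>1) / (t - s\<^sub>1) - u (t, x))"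
  have \<delta>: "\<delta> > 0" "\<delta> \<le> 1" using neg by (auto simp: \<delta>_def not_le)
  have gap: "u (t, x) + \<delta> \<le> u (s\<^sub>1, y) + c (x - y) / (t - s\<^sub>1)" if "y \<in> cball x 1" for y
    using y1(2)[OF that] by (auto simp: \<delta>_def)
  have "(t, x) \<in> {0..T} \<times> UNIV" using t by simp
  then obtain \<rho> where \<rho>: "\<rho> > 0"
    "\<And>z. z \<in> {0..T} \<times> UNIV \<Longrightarrow> dist z (t, x) < \<rho> \<Longrightarrow> dist (u z) (u (t, x)) < \<delta> / 2"
    using cont \<delta> unfolding continuous_on_iff by (metis half_gt_zero)
  \<comment> \<open>Staying at \<open>x\<close> costs nothing, so by continuity
    \<open>(s\<^sub>2, x)\<close> is the point that beats the gap on the initial face.\<close>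
  obtain s\<^sub>2 where s2: "max s\<^sub>1 (t - \<rho>) < s\<^sub>2" "s\<^sub>2 < t"
    using dense[of "max s\<^sub>1 (t - \<rho>)" t] \<rho> t by auto
  have "\<bar>u (s\<^sub>2, x) - u (t, x)\<bar> < \<delta> / 2"
    using \<rho>(2)[of "(s\<^sub>2, x)"] s2 t by (auto simp: dist_Pair_Pair dist_real_def)
  then have us2: "u (s\<^sub>2, x) < u (t, x) + \<delta> / 2"
    by linarith
  define s\<^sub>3 where "s\<^sub>3 = (s\<^sub>2 + t) / 2"
  have s3: "s\<^sub>2 < s\<^sub>3" "s\<^sub>3 < t" using s2 by (auto simp: s\<^sub>3_def)
  obtain k k' where k: "\<And>t. (k has_real_derivative k' t) (at t)" "continuous_on UNIV k'"
    and k': "\<And>t. k' t > (0::real)" and kpos: "\<And>t. k t > 0" and kt: "k s\<^sub>2 = \<delta> / 2" "k s\<^sub>3 \<ge> N"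
    using exp_penalty[of "\<delta> / 2" s\<^sub>2 s\<^sub>3 N] \<delta> s3 N by auto
  define \<Psi> where "\<Psi> z = u z + c (x - snd z) / (t - fst z) + k (fst z)" for z
  have \<Psi>2: "\<Psi> (s\<^sub>2, x) < u (t, x) + \<delta>"
    using us2 by (simp add: \<Psi>_def kt)
  define S where "S = {s\<^sub>1..s\<^sub>3} \<times> cball x 1"
  have "continuous_on S \<Psi>"
    unfolding \<Psi>_def S_def using t s3
    by (intro continuous_intros continuous_on_subset[OF cont]
        continuous_on_compose2[OF DERIV_continuous_on[OF k(1)]])
      (auto intro: DERIV_subset[OF k(1)])
  moreover have S2: "(s\<^sub>2, x) \<in> S"
    using s2 s3 by (auto simp: S_def)
  moreover have "compact S"
    by (simp add: S_def compact_Times)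
  ultimately obtain s\<^sub>0 y\<^sub>0 where z0: "(s\<^sub>0, y\<^sub>0) \<in> S" and min: "\<And>z. z \<in> S \<Longrightarrow> \<Psi> (s\<^sub>0, y\<^sub>0) \<le> \<Psi> z"
    using continuous_attains_inf[of S \<Psi>] by (metis empty_iff surj_pair)
  have le: "\<Psi> (s\<^sub>0, y\<^sub>0) < u (t, x) + \<delta>"
    using min[OF S2] \<Psi>2 by simp
  have in0: "s\<^sub>1 \<le> s\<^sub>0" "s\<^sub>0 \<le> s\<^sub>3" "dist x y\<^sub>0 \<le> 1"
    using z0 by (auto simp: S_def)
  have u0: "- M \<le> u (s\<^sub>0, y\<^sub>0)" "u (t, x) \<le> M"
    using M[of s\<^sub>0 y\<^sub>0] M[of t x] in0 t s3 by (auto simp: abs_le_iff)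
  have c0: "0 \<le> c (x - y\<^sub>0) / (t - s\<^sub>0)"
    using in0 s3 by simp
  have less: "c (x - y\<^sub>0) / (t - s\<^sub>0) < N"
    using le u0 kpos[of s\<^sub>0] \<delta> by (simp add: \<Psi>_def N_def)
  have "s\<^sub>0 \<noteq> s\<^sub>3"
    using le u0 kt(2) c0 \<delta> by (auto simp: \<Psi>_def N_def)
  moreover have "dist x y\<^sub>0 \<noteq> 1"
  proof
    assume "dist x y\<^sub>0 = 1"
    then have "\<kappa> \<le> c (x - y\<^sub>0)"
      using c_ge[of "x - y\<^sub>0"] by (simp add: dist_norm)
    moreover have "N * (t - s\<^sub>0) \<le> N * (t - s\<^sub>1)"
      using in0 N by (intro mult_left_mono) auto
    then have "N * (t - s\<^sub>0) < \<kappa>"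
      using near[folded N_def] by (simp add: mult.commute)
    ultimately show False
      using less in0 s3 by (simp add: field_simps)
  qed
  moreover have "s\<^sub>0 \<noteq> s\<^sub>1"
  proof
    assume "s\<^sub>0 = s\<^sub>1"
    then show False
      using gap[of y\<^sub>0] le in0 kpos[of s\<^sub>1] by (simp add: \<Psi>_def)
  qed
  ultimately have "(s\<^sub>0, y\<^sub>0) \<in> {s\<^sub>1<..<s\<^sub>3} \<times> ball x 1"
    using in0 by simp
  then have "\<forall>\<^sub>F z in nhds (s\<^sub>0, y\<^sub>0). z \<in> {s\<^sub>1<..<s\<^sub>3} \<times> ball x 1"
    by (intro eventually_nhds_in_open open_Times) auto
  then have ev: "\<forall>\<^sub>F z in nhds (s\<^sub>0, y\<^sub>0). \<Psi> z \<ge> \<Psi> (s\<^sub>0, y\<^sub>0)"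
    by eventually_elim (auto intro!: min simp: S_def)
  have "k' s\<^sub>0 \<le> 0"
    using ev in0 t s3 \<open>s\<^sub>0 \<noteq> s\<^sub>1\<close> unfolding \<Psi>_def
    by (intro supersolution_contact[OF sup _ _ _ k, of s\<^sub>0 t y\<^sub>0 x]) auto
  with k'[of s\<^sub>0] show False by simp
qed


section \<open>From short steps to the representation formula\<close>

lemma bounded_on_slab:
  fixes u :: "real \<times> 'a \<Rightarrow> real"
  assumes "continuous_on ({0..T} \<times> UNIV) u"
  obtains M where "M \<ge> 0" "\<And>t x. t \<in> {0..T} \<Longrightarrow> x \<in> cball y r \<Longrightarrow> \<bar>u (t, x)\<bar> \<le> M"
proof -
  have "compact (u ` ({0..T} \<times> cball y r))"
    by (intro compact_continuous_image continuous_on_subset[OF assms] compact_Times) auto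
  then obtain M where "\<forall>v \<in> u ` ({0..T} \<times> cball y r). norm v \<le> M"
    using bounded_iff compact_imp_bounded by metis
  then show ?thesis
    by (intro that[of "max 0 M"]) (auto simp: le_max_iff_disj)
qed

text \<open>The local inequality is chained along the segment from \<open>(s, y)\<close> to
  \<open>(t, x)\<close> in \<open>n\<close> equal steps; at constant velocity the step costs add up
  exactly to the total cost.\<close>

lemma subsolution_le_interior:
  fixes u :: "real \<times> 'a \<Rightarrow> real"
  assumes cont: "continuous_on ({0..T} \<times> UNIV) u" and sub: "viscosity_subsolution H T u"
    and t: "0 \<le> s" "s < t" "t < T"
  shows "u (t, x) \<le> u (s, y) + c (x - y) / (t - s)"
proof -
  \<comment> \<open>The extra \<open>1\<close> keeps the unit ball around every intermediate point
    inside the ball on which \<open>M\<close> bounds \<open>u\<close>.\<close>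
  define R where "R = norm (x - y) + 1"
  obtain M where M0: "M \<ge> 0" and M: "\<And>t z. t \<in> {0..T} \<Longrightarrow> z \<in> cball y R \<Longrightarrow> \<bar>u (t, z)\<bar> \<le> M"
    using bounded_on_slab[OF cont] by metis
  \<comment> \<open>Large enough for each step to have length below \<open>1\<close> and a duration
    short enough for \<open>subsolution_local\<close>.\<close>
  obtain n :: nat where n: "max 1 (max (norm (x - y)) ((t - s) * (2 * M + 1) / \<kappa>)) < real n"
    using reals_Archimedean2 by blast
  then have n0: "real n > 0" by simp
  define h where "h = (t - s) / n"
  define d where "d = (x - y) /\<^sub>R real n"
  have h: "h > 0" "h * (2 * M + 1) < \<kappa>"
    using t n n0 kappa_pos by (auto simp: h_def field_simps)
  have d: "norm d < 1"
    using n n0 by (simp add: d_def divide_simps)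
  have cd: "c d / h = c (x - y) / (t - s) / n"
    unfolding d_def c_scaleR h_def using n0 t by (simp add: power2_eq_square field_simps)
  have "u (s + i * h, y + real i *\<^sub>R d) \<le> u (s, y) + i * (c d / h)" if "i \<le> n" for i :: nat
    using that
  proof (induction i)
    case (Suc i)
    define s' where "s' = s + i * h"
    define y' where "y' = y + real i *\<^sub>R d"
    have "norm (real i *\<^sub>R d) = real i * norm (x - y) / real n"
      by (simp add: d_def divide_inverse)
    also have "\<dots> \<le> norm (x - y)"
      using Suc.prems n0 mult_right_mono[of "real i" "real n" "norm (x - y)"]
      by (simp add: pos_divide_le_eq mult.commute)
    finally have "norm (real i *\<^sub>R d) \<le> norm (x - y)" .
    then have sub_ball: "cball y' 1 \<subseteq> cball y R"
      by (simp add: cball_subset_cball_iff dist_norm y'_def R_def)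
    have "real (Suc i) * h \<le> real n * h"
      using Suc.prems h by (intro mult_right_mono) auto
    then have le: "s' + h \<le> t"
      using n0 by (simp add: s'_def h_def field_simps)
    have "u (s' + h, y' + d) \<le> u (s', y') + c ((y' + d) - y') / ((s' + h) - s')"
      using h d t le sub_ball
      by (intro subsolution_local[OF cont sub _ _ _ M]) (auto simp: s'_def)
    moreover have "u (s', y') \<le> u (s, y) + i * (c d / h)"
      using Suc by (simp add: s'_def y'_def)
    moreover have "s' + h = s + real (Suc i) * h" "y' + d = y + real (Suc i) *\<^sub>R d"
      by (simp_all add: s'_def y'_def algebra_simps)
    ultimately show ?case by (simp add: algebra_simps add_divide_distrib)
  qed simp
  moreover have "s + n * h = t" "y + real n *\<^sub>R d = x" "n * (c d / h) = c (x - y) / (t - s)"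
    using n0 cd by (simp_all add: h_def d_def)
  ultimately show ?thesis
    by (metis order_refl)
qed

text \<open>The equation holds only before time \<open>T\<close>; the case \<open>t = T\<close>
  follows by continuity of \<open>u\<close>.\<close>

lemma subsolution_le:
  fixes u :: "real \<times> 'a \<Rightarrow> real"
  assumes cont: "continuous_on ({0..T} \<times> UNIV) u" and sub: "viscosity_subsolution H T u"
    and t: "0 \<le> s" "s < t" "t \<le> T"
  shows "u (t, x) \<le> u (s, y) + c (x - y) / (t - s)"
proof (cases "t = T")
  case True
  have "continuous_on {(s + T) / 2..T} (\<lambda>t. u (s, y) + c (x - y) / (t - s) - u (t, x))"
    using t True by (intro continuous_intros continuous_on_compose2[OF cont]) auto
  then have "((\<lambda>t. u (s, y) + c (x - y) / (t - s) - u (t, x)) \<longlongrightarrow> u (s, y) + c (x - y) / (T - s) - u (T, x))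
      (at T within {(s + T) / 2..T})"
    using t True by (auto simp: continuous_on_def)
  moreover have "\<forall>\<^sub>F t in at T within {(s + T) / 2..T}. 0 \<le> u (s, y) + c (x - y) / (t - s) - u (t, x)"
    using t True unfolding eventually_at_topological
    by (auto intro!: exI[of _ UNIV] subsolution_le_interior[OF cont sub])
  moreover have "at T within {(s + T) / 2..T} \<noteq> bot"
    using t True by (simp add: at_within_Icc_at_left)
  ultimately show ?thesis
    using tendsto_lowerbound True by fastforce
next
  case False
  then show ?thesis using t by (intro subsolution_le_interior[OF cont sub]) auto
qed

text \<open>The points \<open>(s, y)\<close> with equality in the inequality above lie on lines of bounded speed, because \<open>u\<close> is bounded near \<open>x\<close>; hence they
  stay in a compact set and can be followed back to time \<open>0\<close>. No growth condition on \<open>u\<close> is needed.\<close>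

lemma viscosity_representation:
  fixes u :: "real \<times> 'a \<Rightarrow> real"
  assumes cont: "continuous_on ({0..T} \<times> UNIV) u"
    and sub: "viscosity_subsolution H T u" and sup: "viscosity_supersolution H T u"
    and t: "0 < t" "t \<le> T"
  shows "\<exists>y. u (t, x) = u (0, y) + c (x - y) / t"
proof -
  note le = subsolution_le[OF cont sub]
  obtain M where M0: "M \<ge> 0" and M: "\<And>t z. t \<in> {0..T} \<Longrightarrow> z \<in> cball x 1 \<Longrightarrow> \<bar>u (t, z)\<bar> \<le> M"
    using bounded_on_slab[OF cont] by metis
  \<comment> \<open>Points through which an optimal path to \<open>(t, x)\<close> passes, as the
    reverse inequality always holds.\<close>
  define calib where "calib s y \<longleftrightarrow> 0 \<le> s \<and> s < t \<and> u (s, y) + c (x - y) / (t - s) \<le> u (t, x)" for s y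
  define R where "R = max 1 (2 * M * t / \<kappa>)"
  have bound: "norm (x - y) \<le> R" if "calib s y" for s y
  proof (cases "norm (x - y) \<le> 1")
    case False
    have s: "0 \<le> s" "s < t" "u (s, y) + c (x - y) / (t - s) \<le> u (t, x)"
      using that by (auto simp: calib_def)
    \<comment> \<open>Chosen so that \<open>y'\<close> lies on the segment at distance
      \<open>1\<close> from \<open>x\<close>, where \<open>M\<close> controls \<open>u\<close>. The
      remaining part of the segment carries the fraction \<open>\<theta>\<close> of the cost, which
      is thus at most \<open>2 * M\<close>.\<close>
    define \<theta> where "\<theta> = 1 / norm (x - y)"
    have \<theta>: "0 < \<theta>" "\<theta> < 1" using False by (auto simp: \<theta>_def not_le divide_less_eq_1)
    define s' where "s' = t - \<theta> * (t - s)"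
    define y' where "y' = x - \<theta> *\<^sub>R (x - y)"
    have diffs: "s' - s = (1 - \<theta>) * (t - s)" "y' - y = (1 - \<theta>) *\<^sub>R (x - y)"
      by (simp_all add: s'_def y'_def algebra_simps)
    have pos: "(1 - \<theta>) * (t - s) > 0" "\<theta> * (t - s) > 0" using \<theta> s by auto
    have s': "s < s'" "s' < t" using pos diffs(1) by (simp_all add: s'_def)
    have "u (s', y') \<le> u (s, y) + c (y' - y) / (s' - s)"
      using s s' t by (intro le) auto
    also have "c (y' - y) / (s' - s) = (1 - \<theta>) * (c (x - y) / (t - s))"
      using \<theta> by (simp add: diffs c_scaleR power2_eq_square)
    finally have "\<theta> * (c (x - y) / (t - s)) \<le> u (t, x) - u (s', y')"
      using s(3) unfolding left_diff_distrib mult_1 by linarith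
    moreover have "y' \<in> cball x 1"
      using \<theta> False by (simp add: y'_def \<theta>_def dist_norm)
    then have "u (t, x) - u (s', y') \<le> 2 * M"
      using M[of t x] M[of s' y'] t s s' by (auto simp: abs_le_iff)
    ultimately have "\<theta> * (c (x - y) / (t - s)) \<le> 2 * M"
      by linarith
    then have "\<theta> * c (x - y) \<le> 2 * M * (t - s)"
      using s by (simp add: field_simps)
    moreover have "\<theta> * (\<kappa> * (norm (x - y))\<^sup>2) \<le> \<theta> * c (x - y)"
      using \<theta> c_ge by (intro mult_left_mono) auto
    moreover have "\<theta> * (\<kappa> * (norm (x - y))\<^sup>2) = \<kappa> * norm (x - y)"
      using False by (simp add: \<theta>_def power2_eq_square)
    moreover have "2 * M * (t - s) \<le> 2 * M * t"
      using M0 s by (intro mult_left_mono) auto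
    ultimately have "norm (x - y) \<le> 2 * M * t / \<kappa>"
      using kappa_pos by (simp add: field_simps)
    then show ?thesis by (simp add: R_def)
  qed (simp add: R_def)
  \<comment> \<open>The step length depends on a bound of \<open>u\<close> near \<open>y\<close>, so
    plain iteration might stall before time \<open>0\<close>; a calibrated point of least time is
    used instead.\<close>
  have stepback: "\<exists>s'<s. 0 \<le> s' \<and> (\<exists>y'. u (s', y') + c (y - y') / (s - s') \<le> u (s, y))" if "0 < s" "s \<le> T" for s y
  proof -
    obtain M where M0: "M \<ge> 0" and M: "\<And>t z. t \<in> {0..T} \<Longrightarrow> z \<in> cball y 1 \<Longrightarrow> \<bar>u (t, z)\<bar> \<le> M"
      using bounded_on_slab[OF cont] by metis
    have "max 0 (s - \<kappa> / (2 * M + 1)) < s"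
      using that M0 kappa_pos by simp
    then obtain s' where s': "max 0 (s - \<kappa> / (2 * M + 1)) < s'" "s' < s"
      using dense by blast
    then have "(s - s') * (2 * M + 1) < \<kappa>"
      using M0 by (simp add: field_simps)
    then show ?thesis
      using supersolution_local[OF cont sup _ _ _ M, of s' s] s' that by auto
  qed
  obtain s\<^sub>1 y\<^sub>1 where c1: "calib s\<^sub>1 y\<^sub>1"
    using stepback[of t x] t unfolding calib_def by blast
  \<comment> \<open>Compact, since calibrated points lie within \<open>R\<close> of \<open>x\<close>
    and times up to \<open>s\<^sub>1\<close> stay away from the singularity at
    \<open>t\<close>.\<close>
  define S where "S = {z \<in> {0..s\<^sub>1} \<times> cball x R. u z + c (x - snd z) / (t - fst z) \<le> u (t, x)}"
  have s1: "0 \<le> s\<^sub>1" "s\<^sub>1 < t" using c1 by (auto simp: calib_def)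
  have "continuous_on ({0..s\<^sub>1} \<times> cball x R) (\<lambda>z. u z + c (x - snd z) / (t - fst z))"
    using t s1 by (intro continuous_intros continuous_on_subset[OF cont]) auto
  then have "closed S"
    unfolding S_def
    by (intro continuous_closed_preimage[of _ _ "{..u (t, x)}", unfolded vimage_def Int_def, simplified] closed_Times) auto
  moreover have "S \<subseteq> {0..s\<^sub>1} \<times> cball x R"
    by (auto simp: S_def)
  moreover have "compact ({0..s\<^sub>1} \<times> cball x R)"
    by (intro compact_Times) auto
  ultimately have "compact S"
    by (metis compact_Int_closed inf.absorb_iff2)
  moreover have "(s\<^sub>1, y\<^sub>1) \<in> S"
    using c1 bound[OF c1] by (auto simp: S_def calib_def dist_norm)
  moreover have "continuous_on S fst"
    by (intro continuous_intros)
  ultimately obtain s y where sy: "(s, y) \<in> S" and min: "\<And>z. z \<in> S \<Longrightarrow> s \<le> fst z"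
    using continuous_attains_inf[of S fst] by (metis empty_iff fst_conv surj_pair)
  have csy: "0 \<le> s" "s \<le> s\<^sub>1" "s < t" "u (s, y) + c (x - y) / (t - s) \<le> u (t, x)"
    using sy s1 by (auto simp: S_def)
  have "s = 0"
  proof (rule ccontr)
    assume "s \<noteq> 0"
    then obtain s' y' where s': "0 \<le> s'" "s' < s" "u (s', y') + c (y - y') / (s - s') \<le> u (s, y)"
      using stepback[of s y] csy t by auto
    \<comment> \<open>Splicing the two segments gives an earlier calibrated point, against
      minimality.\<close>
    have "c (x - y') / (t - s') \<le> c (x - y) / (t - s) + c (y - y') / (s - s')"
      using c_triangle[of "t - s" "s - s'" "x - y" "y - y'"] csy s' by simp
    then have c': "calib s' y'"
      using csy s' by (auto simp: calib_def)
    then have "(s', y') \<in> S"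
      using bound[OF c'] csy s' by (auto simp: S_def calib_def dist_norm)
    with min[of "(s', y')"] s' show False by simp
  qed
  moreover have "u (t, x) \<le> u (0, y) + c (x - y) / t"
    using le[of 0 t x y] t by simp
  ultimately show ?thesis
    using csy by (intro exI[of _ y]) simp
qed

lemma viscosity_solution_final:
  assumes "viscosity_solution H T u0 u" "T > 0"
  shows "u (T, x) = Q T u0 x"
proof -
  have cont: "continuous_on ({0..T} \<times> UNIV) u" and "\<And>x. u (0, x) = u0 x"
    and sub: "viscosity_subsolution H T u" and sup: "viscosity_supersolution H T u"
    using assms by (auto simp: viscosity_solution_def)
  then show ?thesis
    using viscosity_representation[OF cont sub sup, of T x] subsolution_le[OF cont sub, of 0 T x] assms(2)
    by (auto intro!: Q_eqI[symmetric])
qed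

end

section \<open>The Hopf--Lax solution\<close>

text \<open>Applied in space-time with \<open>d = (1, q)\<close>, so that
  \<open>z - h *\<^sub>R d\<close> runs back along a path of velocity \<open>q\<close>.\<close>

lemma directional_derivative_le:
  assumes "GDERIV v z :> g" and "\<forall>\<^sub>F h in at_right 0. v z - v (z - h *\<^sub>R d) \<le> h * a"
  shows "g \<bullet> d \<le> a"
proof -
  have "((\<lambda>h. z - h *\<^sub>R d) has_derivative (\<lambda>h. - (h *\<^sub>R d))) (at 0)"
    by (auto intro!: derivative_eq_intros)
  from has_derivative_compose[OF this, of v "\<lambda>h. h \<bullet> g"] assms(1)
  have "((\<lambda>h. v (z - h *\<^sub>R d)) has_derivative (\<lambda>h. - (h *\<^sub>R d) \<bullet> g)) (at 0)"
    by (simp add: gderiv_def)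
  then have "((\<lambda>h. v (z - h *\<^sub>R d)) has_real_derivative - (d \<bullet> g)) (at 0)"
    by (rule has_derivative_imp_has_field_derivative) simp
  then have "(\<lambda>h. (v (z - h *\<^sub>R d) - v z) / h) \<midarrow>0\<rightarrow> - (d \<bullet> g)"
    unfolding DERIV_def by simp
  then have "((\<lambda>h. (v (z - h *\<^sub>R d) - v z) / h) \<longlongrightarrow> - (d \<bullet> g)) (at_right 0)"
    by (rule filterlim_mono) (auto simp: at_le)
  moreover have "\<forall>\<^sub>F h in at_right 0. - a \<le> (v (z - h *\<^sub>R d) - v z) / h"
    using assms(2) eventually_at_right_less[of "0::real"]
    by eventually_elim (simp add: field_simps)
  ultimately have "- a \<le> - (d \<bullet> g)"
    by (intro tendsto_lowerbound) auto
  then show ?thesis by (simp add: inner_commute)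
qed

lemma directional_derivative_ge:
  assumes "GDERIV v z :> g" and "\<forall>\<^sub>F h in at_right 0. v z - v (z - h *\<^sub>R d) \<ge> h * a"
  shows "g \<bullet> d \<ge> a"
proof -
  have "GDERIV (\<lambda>z. - v z) z :> - g"
    using assms(1) by (auto simp: gderiv_def dest: has_derivative_minus)
  from directional_derivative_le[OF this, of d "- a"] assms(2) show ?thesis
    by (simp add: algebra_simps)
qed

lemma eventually_along_ray:
  fixes z :: "'a::real_normed_vector"
  assumes "\<forall>\<^sub>F w in nhds z. R w"
  shows "\<forall>\<^sub>F h in at_right 0. R (z - h *\<^sub>R d)"
proof -
  have "((\<lambda>h. z - h *\<^sub>R d) \<longlongrightarrow> z - 0 *\<^sub>R d) (at_right 0)"
    by (intro tendsto_intros)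
  with assms show ?thesis
    by (simp add: filterlim_iff)
qed

section \<open>Dynamic programming and existence\<close>

context quadratic_cost
begin

text \<open>Time \<open>0\<close> is separate: there division by zero would drop the cost and leave
  the infimum of \<open>f\<close>.\<close>

definition hopf_lax :: "('a \<Rightarrow> real) \<Rightarrow> real \<times> 'a \<Rightarrow> real" where
  "hopf_lax f z = (if fst z = 0 then f (snd z) else Q (fst z) f (snd z))"

lemma hopf_lax_attained:
  assumes "f \<in> Lip" "0 \<le> t"
  obtains y where "0 < t \<Longrightarrow> hopf_lax f (t, x) = f y + c (x - y) / t"
proof (cases "t = 0")
  case False
  obtain L where "L-lipschitz_on UNIV f" using assms by (auto simp: Lip_def)
  with that False assms(2) show ?thesis
    by (metis Q_attained fst_conv snd_conv hopf_lax_def order_le_less)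
qed (use that in auto)

lemma hopf_lax_le_initial:
  assumes "f \<in> Lip" "0 < t"
  shows "hopf_lax f (t, x) \<le> f y + c (x - y) / t"
  using assms Q_le by (auto simp: Lip_def hopf_lax_def)

lemma hopf_lax_dynamic_le:
  assumes "f \<in> Lip" "0 \<le> s" "s < t"
  shows "hopf_lax f (t, x) \<le> hopf_lax f (s, y) + c (x - y) / (t - s)"
proof (cases "s = 0")
  case True
  then show ?thesis
    using hopf_lax_le_initial[OF assms(1), of t x y] assms by (simp add: hopf_lax_def)
next
  case False
  obtain z where z: "hopf_lax f (s, y) = f z + c (y - z) / s"
    using hopf_lax_attained[OF assms(1,2)] False assms by (metis order_le_less)
  have "hopf_lax f (t, x) \<le> f z + c (x - z) / t"
    using assms by (intro hopf_lax_le_initial) auto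
  also have "c (x - z) / t \<le> c (x - y) / (t - s) + c (y - z) / s"
    using c_triangle[of "t - s" s "x - y" "y - z"] assms False by simp
  finally show ?thesis using z by simp
qed

text \<open>The velocity \<open>q\<close> is that of the straight line from the minimiser to
  \<open>x\<close>. One \<open>q\<close> serves all \<open>s\<close>, as the limit
  \<open>s \<rightarrow> t\<close> in the supersolution test requires.\<close>

lemma hopf_lax_dynamic_ge:
  assumes "f \<in> Lip" "0 < t"
  obtains q where "\<And>s. 0 \<le> s \<Longrightarrow> s < t \<Longrightarrow>
    hopf_lax f (s, x - (t - s) *\<^sub>R q) + (t - s) * c q \<le> hopf_lax f (t, x)"
proof -
  obtain z where z: "hopf_lax f (t, x) = f z + c (x - z) / t"
    using hopf_lax_attained[OF assms(1), of t] assms by (metis order_le_less)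
  define q where "q = (x - z) /\<^sub>R t"
  have tq: "x - z = t *\<^sub>R q" using assms by (simp add: q_def)
  have cq: "c (x - z) / t = t * c q"
    using assms by (simp add: tq c_scaleR power2_eq_square)
  have "hopf_lax f (s, x - (t - s) *\<^sub>R q) + (t - s) * c q \<le> hopf_lax f (t, x)" if "0 \<le> s" "s < t" for s
  proof (cases "s = 0")
    case True
    have "x - t *\<^sub>R q = z" using tq by (simp add: algebra_simps)
    moreover have "hopf_lax f (0, z) = f z" by (simp add: hopf_lax_def)
    ultimately show ?thesis
      using z cq True by simp
  next
    case False
    have "x - (t - s) *\<^sub>R q - z = s *\<^sub>R q"
      using tq by (simp add: algebra_simps)
    then have "hopf_lax f (s, x - (t - s) *\<^sub>R q) \<le> f z + s * c q"
      using hopf_lax_le_initial[OF assms(1), of s "x - (t - s) *\<^sub>R q" z] that False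
      by (simp add: c_scaleR power2_eq_square)
    then show ?thesis
      using z cq by (simp add: algebra_simps)
  qed
  then show ?thesis using that by blast
qed

lemma hopf_lax_lipschitz_space:
  assumes "L-lipschitz_on UNIV f" "0 \<le> t"
  shows "L-lipschitz_on UNIV (\<lambda>x. hopf_lax f (t, x))"
proof (cases "t = 0")
  case True
  then show ?thesis using assms by (simp add: hopf_lax_def)
next
  case False
  then have "(\<lambda>x. hopf_lax f (t, x)) = Q t f" by (simp add: hopf_lax_def)
  then show ?thesis using Q_lipschitz[OF assms(1), of t] assms False by (metis order_le_less)
qed

text \<open>Staying put is free, so values decrease in time; conversely \<open>young\<close> trades
  the spatial variation along the optimal path against its cost.\<close>

lemma hopf_lax_lipschitz_time:
  assumes L: "L-lipschitz_on UNIV f" and "0 \<le> s" "s \<le> t"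
  shows "\<bar>hopf_lax f (t, x) - hopf_lax f (s, x)\<bar> \<le> L\<^sup>2 / (4 * \<kappa>) * (t - s)"
proof (cases "s = t")
  case False
  have f: "f \<in> Lip" using L by (auto simp: Lip_def)
  have st: "s < t" "0 < t" using assms False by auto
  obtain q where q: "hopf_lax f (s, x - (t - s) *\<^sub>R q) + (t - s) * c q \<le> hopf_lax f (t, x)"
    using hopf_lax_dynamic_ge[OF f st(2), of x] assms(2) st by metis
  have "hopf_lax f (s, x) \<le> hopf_lax f (s, x - (t - s) *\<^sub>R q) + L * norm ((t - s) *\<^sub>R q)"
    using lipschitz_real_le[OF hopf_lax_lipschitz_space[OF L assms(2)], of x "x - (t - s) *\<^sub>R q"] by simp
  also have "L * norm ((t - s) *\<^sub>R q) \<le> (t - s) * c q + L\<^sup>2 / (4 * \<kappa>) * (t - s)"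
    using young[of "t - s" L "(t - s) *\<^sub>R q"] st by (simp add: c_scaleR power2_eq_square)
  finally have "hopf_lax f (s, x) \<le> hopf_lax f (t, x) + L\<^sup>2 / (4 * \<kappa>) * (t - s)"
    using q by simp
  moreover have "hopf_lax f (t, x) \<le> hopf_lax f (s, x)"
    using hopf_lax_dynamic_le[OF f assms(2) st(1), of x x] by simp
  ultimately show ?thesis
    using st kappa_pos by (auto simp: abs_le_iff intro: order_trans[of _ 0])
qed simp

lemma hopf_lax_continuous:
  assumes "f \<in> Lip"
  shows "continuous_on ({0..} \<times> UNIV) (hopf_lax f)"
proof -
  obtain L where L: "L-lipschitz_on UNIV f" using assms by (auto simp: Lip_def)
  have L0: "L \<ge> 0" using L by (rule lipschitz_on_nonneg)
  define K where "K = L\<^sup>2 / (4 * \<kappa>)"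
  have K: "K \<ge> 0" using kappa_pos by (simp add: K_def)
  have "(K + L)-lipschitz_on ({0..} \<times> UNIV) (hopf_lax f)"
  proof (rule lipschitz_onI)
    fix z w :: "real \<times> 'a"
    assume "z \<in> {0..} \<times> UNIV" "w \<in> {0..} \<times> UNIV"
    then obtain t x s y where zw: "z = (t, x)" "w = (s, y)" "0 \<le> t" "0 \<le> s"
      by auto
    have "\<bar>hopf_lax f (t, x) - hopf_lax f (s, x)\<bar> \<le> K * \<bar>t - s\<bar>"
      using hopf_lax_lipschitz_time[OF L, of s t x] hopf_lax_lipschitz_time[OF L, of t s x] zw
      by (cases "s \<le> t") (auto simp: K_def abs_minus_commute)
    also have "\<dots> \<le> K * dist z w"
      using K dist_fst_le[of z w] by (intro mult_left_mono) (auto simp: zw dist_real_def)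
    finally have "dist (hopf_lax f (t, x)) (hopf_lax f (s, x)) \<le> K * dist z w"
      by (simp add: dist_real_def)
    moreover have "dist (hopf_lax f (s, x)) (hopf_lax f (s, y)) \<le> L * dist x y"
      using lipschitz_onD[OF hopf_lax_lipschitz_space[OF L zw(4)]] by simp
    moreover have "L * dist x y \<le> L * dist z w"
      using L0 dist_snd_le[of z w] by (intro mult_left_mono) (auto simp: zw)
    moreover have "dist (hopf_lax f z) (hopf_lax f w)
      \<le> dist (hopf_lax f (t, x)) (hopf_lax f (s, x)) + dist (hopf_lax f (s, x)) (hopf_lax f (s, y))"
      unfolding zw by (rule dist_triangle)
    ultimately show "dist (hopf_lax f z) (hopf_lax f w) \<le> (K + L) * dist z w"
      by (simp add: distrib_right)
  qed (use K L0 in simp)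
  then show ?thesis by (rule lipschitz_on_continuous_on)
qed

lemma hopf_lax_solution:
  assumes f: "f \<in> Lip"
  shows "viscosity_solution H T f (hopf_lax f)"
  unfolding viscosity_solution_def
proof (intro conjI allI)
  show "continuous_on ({0..T} \<times> UNIV) (hopf_lax f)"
    by (rule continuous_on_subset[OF hopf_lax_continuous[OF f]]) auto
  show "hopf_lax f (0, x) = f x" for x
    by (simp add: hopf_lax_def)
  show "viscosity_subsolution H T (hopf_lax f)"
    unfolding viscosity_subsolution_def
  proof (intro allI impI ballI)
    fix v G and z :: "real \<times> 'a"
    assume v: "C1_test_function T v G" and z: "z \<in> {0<..<T} \<times> UNIV"
      and max: "\<forall>\<^sub>F w in nhds z. hopf_lax f w - v w \<le> hopf_lax f z - v z"
    obtain t x where tx: "z = (t, x)" "0 < t" using z by auto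
    \<comment> \<open>The velocity dual to the momentum \<open>snd (G z)\<close>; it gives equality
      in Fenchel's inequality, so testing this single ray suffices.\<close>
    define q where "q = A (snd (G z))"
    have "\<forall>\<^sub>F h in at_right 0. h < t"
      using tx by (intro eventually_at_rightI[of 0 t]) auto
    with eventually_along_ray[OF max, of "(1, q)"] eventually_at_right_less[of "0::real"]
    have "\<forall>\<^sub>F h in at_right 0. v z - v (z - h *\<^sub>R (1, q)) \<le> h * c q"
    proof eventually_elim
      case (elim h)
      have "hopf_lax f z \<le> hopf_lax f (z - h *\<^sub>R (1, q)) + h * c q"
        using hopf_lax_dynamic_le[OF f, of "t - h" t x "x - h *\<^sub>R q"] elim tx
        by (simp add: c_scaleR power2_eq_square)
      then show ?case using elim(1) by simp
    qed
    moreover have "GDERIV v z :> G z"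
      using v z unfolding C1_test_function_def by blast
    ultimately have "G z \<bullet> (1, q) \<le> c q"
      by (rule directional_derivative_le[rotated])
    moreover have "snd (G z) \<bullet> q = 2 * H (snd (G z))" "c q = H (snd (G z))"
      using H_B[of q] by (simp_all add: q_def B_A H_def inner_commute)
    ultimately show "fst (G z) + H (snd (G z)) \<le> 0"
      by (simp add: inner_prod_def)
  qed
  show "viscosity_supersolution H T (hopf_lax f)"
    unfolding viscosity_supersolution_def
  proof (intro allI impI ballI)
    fix v G and z :: "real \<times> 'a"
    assume v: "C1_test_function T v G" and z: "z \<in> {0<..<T} \<times> UNIV"
      and min: "\<forall>\<^sub>F w in nhds z. hopf_lax f w - v w \<ge> hopf_lax f z - v z"
    obtain t x where tx: "z = (t, x)" "0 < t" using z by auto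
    obtain q where q: "\<And>s. 0 \<le> s \<Longrightarrow> s < t \<Longrightarrow>
        hopf_lax f (s, x - (t - s) *\<^sub>R q) + (t - s) * c q \<le> hopf_lax f (t, x)"
      using hopf_lax_dynamic_ge[OF f tx(2)] by blast
    have "\<forall>\<^sub>F h in at_right 0. h < t"
      using tx by (intro eventually_at_rightI[of 0 t]) auto
    with eventually_along_ray[OF min, of "(1, q)"] eventually_at_right_less[of "0::real"]
    have "\<forall>\<^sub>F h in at_right 0. v z - v (z - h *\<^sub>R (1, q)) \<ge> h * c q"
    proof eventually_elim
      case (elim h)
      then show ?case using q[of "t - h"] tx by simp
    qed
    moreover have "GDERIV v z :> G z"
      using v z unfolding C1_test_function_def by blast
    ultimately have "G z \<bullet> (1, q) \<ge> c q"
      by (rule directional_derivative_ge[rotated])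
    \<comment> \<open>Fenchel's inequality for the optimal \<open>q\<close>, by completing the
      square.\<close>
    moreover have "c (A (snd (G z)) - q) = H (snd (G z)) - snd (G z) \<bullet> q + c q"
      using c_add[of "A (snd (G z))" "- q"] H_B[of "A (snd (G z))"] by (simp add: B_A)
    then have "0 \<le> H (snd (G z)) - snd (G z) \<bullet> q + c q"
      by (metis c_nonneg)
    ultimately show "fst (G z) + H (snd (G z)) \<ge> 0"
      by (simp add: inner_prod_def)
  qed
qed

lemma S_plus_eq:
  assumes "f \<in> Lip" "T > 0"
  shows "S_plus H T f = Q T f"
  unfolding S_plus_def
proof (rule the_equality)
  have "Q T f = (\<lambda>x. hopf_lax f (T, x))"
    using assms(2) by (simp add: hopf_lax_def)
  then show "\<exists>u. viscosity_solution H T f u \<and> Q T f = (\<lambda>x. u (T, x))"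
    using hopf_lax_solution[OF assms(1)] by blast
next
  fix \<psi> assume "\<exists>u. viscosity_solution H T f u \<and> \<psi> = (\<lambda>x. u (T, x))"
  then show "\<psi> = Q T f"
    using viscosity_solution_final[OF _ assms(2)] by auto
qed

end

section \<open>Semiconcave functions\<close>

lemma gderiv_touching_eq:
  assumes "GDERIV f z :> g" "GDERIV F z :> g'" "\<forall>\<^sub>F w in nhds z. f w \<le> F w" "f z = F z"
  shows "g = g'"
proof -
  obtain S where S: "open S" "z \<in> S" "\<And>w. w \<in> S \<Longrightarrow> f w \<le> F w"
    using assms(3) unfolding eventually_nhds by blast
  have "((\<lambda>w. F w - f w) has_derivative (\<lambda>h. h \<bullet> g' - h \<bullet> g)) (at z)"
    using assms(1,2) unfolding gderiv_def by (intro has_derivative_diff)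
  then have "(\<lambda>h. h \<bullet> g' - h \<bullet> g) = (\<lambda>h. 0)"
    by (rule differential_zero_maxmin[OF S(2,1)]) (use S(3) assms(4) in auto)
  then have "(g' - g) \<bullet> g' - (g' - g) \<bullet> g = 0"
    by metis
  then show ?thesis
    by (simp flip: inner_diff_right)
qed

text \<open>Both gradients agree by touching, and the first-order error of \<open>f\<close> is at
  most the sum of those of \<open>l\<close> and \<open>F\<close>.\<close>

lemma gderiv_sandwich:
  fixes f :: "'a::euclidean_space \<Rightarrow> real"
  assumes "GDERIV l z :> g" "GDERIV F z :> g'"
    and ev: "\<forall>\<^sub>F w in nhds z. l w \<le> f w \<and> f w \<le> F w" and eq: "l z = f z" "F z = f z"
  shows "GDERIV f z :> g"
proof -
  have gg: "g = g'"
    using ev by (intro gderiv_touching_eq[OF assms(1,2)]) (auto elim: eventually_mono simp: eq)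
  have l: "((\<lambda>w. norm (l w - l z - (w - z) \<bullet> g) / norm (w - z)) \<longlongrightarrow> 0) (at z)"
    and F: "((\<lambda>w. norm (F w - F z - (w - z) \<bullet> g) / norm (w - z)) \<longlongrightarrow> 0) (at z)"
    using assms(1,2) unfolding gg gderiv_def has_derivative_iff_norm by auto
  have "((\<lambda>w. norm (f w - f z - (w - z) \<bullet> g) / norm (w - z)) \<longlongrightarrow> 0) (at z)"
  proof (rule Lim_null_comparison)
    show "((\<lambda>w. norm (l w - l z - (w - z) \<bullet> g) / norm (w - z)
        + norm (F w - F z - (w - z) \<bullet> g) / norm (w - z)) \<longlongrightarrow> 0) (at z)"
      using tendsto_add[OF l F] by simp
    have "\<forall>\<^sub>F w in at z. l w \<le> f w \<and> f w \<le> F w"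
      using ev by (simp add: eventually_at_filter eventually_mono)
    then show "\<forall>\<^sub>F w in at z. norm (norm (f w - f z - (w - z) \<bullet> g) / norm (w - z))
        \<le> norm (l w - l z - (w - z) \<bullet> g) / norm (w - z) + norm (F w - F z - (w - z) \<bullet> g) / norm (w - z)"
    proof eventually_elim
      case (elim w)
      then have "norm (f w - f z - (w - z) \<bullet> g) \<le> norm (l w - l z - (w - z) \<bullet> g) + norm (F w - F z - (w - z) \<bullet> g)"
        using eq by (simp only: real_norm_def) linarith
      then show ?case
        by (simp add: add_divide_distrib[symmetric] divide_right_mono)
    qed
  qed
  then show ?thesis
    by (simp add: gderiv_def has_derivative_iff_norm bounded_linear_inner_left)
qed

section \<open>Lipschitz functions and compact support\<close>

lemma Lip_continuous: "f \<in> Lip \<Longrightarrow> continuous_on S f"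
  by (auto simp: Lip_def intro: lipschitz_on_continuous_on lipschitz_on_subset)

lemma Lip_max:
  assumes "f \<in> Lip" "g \<in> Lip" shows "(\<lambda>x. max (f x) (g x) :: real) \<in> Lip"
proof -
  obtain L M where "L-lipschitz_on UNIV f" "M-lipschitz_on UNIV g"
    using assms by (auto simp: Lip_def)
  then have L: "\<bar>f x - f y\<bar> \<le> L * dist x y" and M: "\<bar>g x - g y\<bar> \<le> M * dist x y"
    and "0 \<le> L" "0 \<le> M" for x y
    by (auto simp: lipschitz_on_def dist_real_def)
  have "(L + M)-lipschitz_on UNIV (\<lambda>x. max (f x) (g x))"
  proof (rule lipschitz_onI)
    fix x y
    have "\<bar>max (f x) (g x) - max (f y) (g y)\<bar> \<le> \<bar>f x - f y\<bar> + \<bar>g x - g y\<bar>"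
      by linarith
    with L[of x y] M[of x y] show "dist (max (f x) (g x)) (max (f y) (g y)) \<le> (L + M) * dist x y"
      by (simp add: dist_real_def distrib_right)
  qed (use \<open>0 \<le> L\<close> \<open>0 \<le> M\<close> in simp)
  then show ?thesis by (auto simp: Lip_def)
qed

lemma Lip_min:
  assumes "f \<in> Lip" "g \<in> Lip" shows "(\<lambda>x. min (f x) (g x) :: real) \<in> Lip"
  using Lip_uminus[OF Lip_max[OF Lip_uminus[OF assms(1)] Lip_uminus[OF assms(2)]]]
  by (simp add: minus_max_eq_min)

lemma Lip_cmult: "f \<in> Lip \<Longrightarrow> (\<lambda>x. a * f x :: real) \<in> Lip"
  unfolding Lip_def by (auto intro: lipschitz_on_cmult_real)

lemma Lip_add: "f \<in> Lip \<Longrightarrow> g \<in> Lip \<Longrightarrow> (\<lambda>x. f x + g x :: real) \<in> Lip"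
  unfolding Lip_def by (auto intro: lipschitz_on_add)

lemma Lip_diff: "f \<in> Lip \<Longrightarrow> g \<in> Lip \<Longrightarrow> (\<lambda>x. f x - g x :: real) \<in> Lip"
  using Lip_add[of f "\<lambda>x. - g x"] Lip_uminus[of g] by simp

lemma Lip_bounded_on_ball:
  fixes f :: "'a::euclidean_space \<Rightarrow> real"
  assumes "f \<in> Lip"
  obtains M where "M \<ge> 0" "\<And>x. norm x \<le> R \<Longrightarrow> \<bar>f x\<bar> \<le> M"
proof -
  have "compact (f ` cball 0 R)"
    by (intro compact_continuous_image Lip_continuous assms) auto
  then obtain M where "\<forall>v \<in> f ` cball 0 R. norm v \<le> M"
    using bounded_iff compact_imp_bounded by metis
  then show ?thesis
    by (intro that[of "max 0 M"]) (auto simp: le_max_iff_disj)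
qed

lemma Lip0_iff:
  fixes f :: "'a::euclidean_space \<Rightarrow> real"
  shows "f \<in> Lip0 \<longleftrightarrow> f \<in> Lip \<and> (\<exists>R. \<forall>x. norm x > R \<longrightarrow> f x = 0)"
proof -
  have "compact (closure (support_on UNIV f)) \<longleftrightarrow> bounded (support_on UNIV f)"
    by simp
  also have "\<dots> \<longleftrightarrow> (\<exists>R. \<forall>x. norm x > R \<longrightarrow> f x = 0)"
    unfolding bounded_iff support_on_def by (auto simp: not_less[symmetric])
  finally show ?thesis by (simp add: Lip0_def)
qed

text \<open>A cone of slope \<open>1\<close>, hence comparable with the cost through
  \<open>young\<close>.\<close>

definition tent :: "real \<Rightarrow> 'a::euclidean_space \<Rightarrow> real" where
  "tent K x = max 0 (K - norm x)"

lemma Lip_tent: "tent K \<in> Lip"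
proof -
  have "1-lipschitz_on UNIV (\<lambda>x::'a. K - norm x)"
  proof (rule lipschitz_onI)
    show "dist (K - norm x) (K - norm y) \<le> 1 * dist x y" for x y :: 'a
      using norm_triangle_ineq3[of x y] by (simp add: dist_norm abs_minus_commute)
  qed simp
  moreover have "0-lipschitz_on UNIV (\<lambda>x::'a. 0::real)"
    by (simp add: lipschitz_on_def)
  ultimately have "(\<lambda>x::'a. max 0 (K - norm x)) \<in> Lip"
    by (intro Lip_max) (auto simp: Lip_def)
  then show ?thesis by (simp add: tent_def[abs_def])
qed

section \<open>Semiconcavity and the reachable set\<close>

context quadratic_cost
begin

text \<open>Equivalent to concavity of \<open>f - c / t\<close>, but stated by touching paraboloids,
  the form in which minimisers of \<open>Q\<close> provide it.\<close>

definition semiconcave :: "real \<Rightarrow> ('a \<Rightarrow> real) \<Rightarrow> bool" where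
  "semiconcave t f \<longleftrightarrow> (\<forall>x. \<exists>p. \<forall>w. f w \<le> f x + p \<bullet> (w - x) + c (w - x) / t)"

lemma c_shift: "c (w - y) = c (x - y) + B (x - y) \<bullet> (w - x) + c (w - x)"
  using c_add[of "x - y" "w - x"] by simp

text \<open>Converts a paraboloid given by its centre \<open>y\<close> into one given by its slope
  at \<open>x\<close>.\<close>

lemma c_shift_divide: "c (w - y) / t = c (x - y) / t + (B (x - y) /\<^sub>R t) \<bullet> (w - x) + c (w - x) / t"
proof -
  have "(B (x - y) /\<^sub>R t) \<bullet> (w - x) = (B (x - y) \<bullet> (w - x)) / t"
    by (simp add: divide_inverse mult.commute)
  then show ?thesis
    by (simp only: c_shift[of w y x] add_divide_distrib)
qed

lemma semiconcave_Q:
  assumes "f \<in> Lip" "t > 0"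
  shows "semiconcave t (Q t f)"
  unfolding semiconcave_def
proof
  fix x
  obtain L where L: "L-lipschitz_on UNIV f" using assms(1) by (auto simp: Lip_def)
  obtain y where y: "Q t f x = f y + c (x - y) / t"
    using Q_attained[OF L assms(2)] by metis
  have "Q t f w \<le> Q t f x + (B (x - y) /\<^sub>R t) \<bullet> (w - x) + c (w - x) / t" for w
    using Q_le[OF L assms(2), of w y] y c_shift_divide[of w y t x] by linarith
  then show "\<exists>p. \<forall>w. Q t f w \<le> Q t f x + p \<bullet> (w - x) + c (w - x) / t"
    by blast
qed

lemma semiconcave_min:
  assumes "semiconcave t f" "semiconcave t g"
  shows "semiconcave t (\<lambda>x. min (f x) (g x))"
  unfolding semiconcave_def
proof
  fix x
  show "\<exists>p. \<forall>w. min (f w) (g w) \<le> min (f x) (g x) + p \<bullet> (w - x) + c (w - x) / t"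
  proof (cases "f x \<le> g x")
    case True
    obtain p where "\<And>w. f w \<le> f x + p \<bullet> (w - x) + c (w - x) / t"
      using assms(1) unfolding semiconcave_def by metis
    with True show ?thesis
      by (intro exI[of _ p] allI) (simp add: min_le_iff_disj min_absorb1)
  next
    case False
    obtain p where "\<And>w. g w \<le> g x + p \<bullet> (w - x) + c (w - x) / t"
      using assms(2) unfolding semiconcave_def by metis
    with False show ?thesis
      by (intro exI[of _ p] allI) (simp add: min_le_iff_disj min_absorb2)
  qed
qed

text \<open>Slopes are averaged and the quadratic term is common. Midpoints are all the
  parallelogram argument for uniqueness needs.\<close>

lemma semiconcave_average:
  assumes "semiconcave t f" "semiconcave t g"
  shows "semiconcave t (\<lambda>x. (f x + g x) / 2)"
  unfolding semiconcave_def
proof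
  fix x
  obtain p q where p: "\<And>w. f w \<le> f x + p \<bullet> (w - x) + c (w - x) / t"
    and q: "\<And>w. g w \<le> g x + q \<bullet> (w - x) + c (w - x) / t"
    using assms unfolding semiconcave_def by metis
  have "(f w + g w) / 2 \<le> (f x + g x) / 2 + ((p + q) /\<^sub>R 2) \<bullet> (w - x) + c (w - x) / t" for w
  proof -
    have *: "((p + q) /\<^sub>R 2) \<bullet> (w - x) = (p \<bullet> (w - x) + q \<bullet> (w - x)) / 2"
      by (simp only: inner_scaleR_left inner_add_left) simp
    have "(a + b) / 2 \<le> (a' + b') / 2 + (r + s) / 2 + d" if "a \<le> a' + r + d" "b \<le> b' + s + d"
      for a b a' b' r s d :: real
      using that by argo
    from this[OF p q] show ?thesis unfolding * .
  qed
  then show "\<exists>p. \<forall>w. (f w + g w) / 2 \<le> (f x + g x) / 2 + p \<bullet> (w - x) + c (w - x) / t"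
    by blast
qed

lemma P_ge:
  assumes "f \<in> Lip" "t > 0"
  shows "f y - c (y - x) / t \<le> P t f x"
proof -
  obtain L where L: "L-lipschitz_on UNIV (\<lambda>y. - f y)" using Lip_uminus[OF assms(1)] by (auto simp: Lip_def)
  show ?thesis
    using Q_le[OF L assms(2), of x y] unfolding P_def c_minus_commute[of y x] by linarith
qed

lemma P_attained:
  assumes "f \<in> Lip" "t > 0"
  obtains y where "P t f x = f y - c (y - x) / t"
proof -
  obtain L where L: "L-lipschitz_on UNIV (\<lambda>y. - f y)" using Lip_uminus[OF assms(1)] by (auto simp: Lip_def)
  obtain y where "Q t (\<lambda>y. - f y) x = - f y + c (x - y) / t"
    using Q_attained[OF L assms(2)] by metis
  then have "P t f x = f y - c (y - x) / t"
    unfolding P_def c_minus_commute[of y x] by linarith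
  then show ?thesis by (rule that)
qed

lemma Q_P_ge:
  assumes "f \<in> Lip" "t > 0"
  shows "f x \<le> Q t (P t f) x"
proof -
  obtain L where L: "L-lipschitz_on UNIV (P t f)" using Lip_P[OF assms] by (auto simp: Lip_def)
  obtain y where "Q t (P t f) x = P t f y + c (x - y) / t"
    using Q_attained[OF L assms(2)] by metis
  then show ?thesis using P_ge[OF assms, of x y] by simp
qed

text \<open>The paraboloid over \<open>f\<close> bounds \<open>P t f\<close> by \<open>a\<close> at
  its centre. With \<open>Q_P_ge\<close> this makes \<open>Q t (P t f)\<close> the semiconcave
  envelope of \<open>f\<close>.\<close>

lemma Q_P_le:
  assumes "f \<in> Lip" "t > 0" "\<And>w. f w \<le> a + c (w - y) / t"
  shows "Q t (P t f) x \<le> a + c (x - y) / t"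
proof -
  obtain L where L: "L-lipschitz_on UNIV (P t f)" using Lip_P[OF assms(1,2)] by (auto simp: Lip_def)
  obtain z where "P t f y = f z - c (z - y) / t"
    using P_attained[OF assms(1,2)] by metis
  then have "P t f y \<le> a" using assms(3)[of z] by simp
  then show ?thesis using Q_le[OF L assms(2), of x y] by simp
qed

lemma Q_P_eq:
  assumes "f \<in> Lip" "t > 0" "semiconcave t f"
  shows "Q t (P t f) = f"
proof (rule ext, rule antisym)
  fix x
  show "f x \<le> Q t (P t f) x" by (rule Q_P_ge[OF assms(1,2)])
  obtain p where p: "\<And>w. f w \<le> f x + p \<bullet> (w - x) + c (w - x) / t"
    using assms(3) unfolding semiconcave_def by metis
  \<comment> \<open>The centre for which the paraboloid has slope \<open>p\<close> at
    \<open>x\<close>.\<close>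
  define y where "y = x - A (t *\<^sub>R p)"
  have "B (x - y) /\<^sub>R t = p" using assms(2) by (simp add: y_def B_A)
  then have "f w \<le> (f x - c (x - y) / t) + c (w - y) / t" for w
    using p[of w] c_shift_divide[of w y t x] by simp
  from Q_P_le[OF assms(1,2) this] show "Q t (P t f) x \<le> f x" by (metis diff_add_cancel)
qed

lemma reachable_set_eq:
  assumes "T > 0"
  shows "reachable_set H T = {f \<in> Lip. semiconcave T f}"
proof (intro set_eqI iffI)
  fix f assume "f \<in> reachable_set H T"
  then obtain u0 where "u0 \<in> Lip" "f = Q T u0"
    using S_plus_eq[OF _ assms] by (auto simp: reachable_set_def)
  then show "f \<in> {f \<in> Lip. semiconcave T f}"
    using semiconcave_Q Lip_Q assms by auto
next
  fix f assume "f \<in> {f \<in> Lip. semiconcave T f}"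
  then have f: "f \<in> Lip" "semiconcave T f" by auto
  have "S_plus H T (P T f) = f"
    using S_plus_eq[OF Lip_P[OF f(1) assms] assms] Q_P_eq[OF f(1) assms f(2)] by simp
  then show "f \<in> reachable_set H T"
    using f Lip_P[OF f(1) assms] by (auto simp: reachable_set_def)
qed

lemma semiconcave_touching:
  assumes "f \<in> Lip" "t > 0" "semiconcave t f"
  obtains y where "f x = P t f y + c (x - y) / t" "\<And>w. f w \<le> P t f y + c (w - y) / t"
proof -
  obtain L where L: "L-lipschitz_on UNIV (P t f)" using Lip_P[OF assms(1,2)] by (auto simp: Lip_def)
  obtain y where "Q t (P t f) x = P t f y + c (x - y) / t"
    using Q_attained[OF L assms(2)] by metis
  then show ?thesis
    using that[of y] Q_le[OF L assms(2)] unfolding Q_P_eq[OF assms] by auto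
qed

lemma gderiv_paraboloid: "GDERIV (\<lambda>w. a + c (w - y) / t) z :> B (z - y) /\<^sub>R t"
proof -
  have "((\<lambda>w. a + c (w - y) * inverse t) has_derivative (\<lambda>h. 0 + (B (z - y) \<bullet> h) * inverse t)) (at z)"
    by (intro has_derivative_add has_derivative_const has_derivative_mult_left has_derivative_c)
  then show ?thesis
    by (simp add: gderiv_def divide_inverse inner_commute mult.commute)
qed

text \<open>Equating the gradient of \<open>f\<close> with that of the paraboloid and solving for
  its centre.\<close>

lemma touching_center:
  assumes "t > 0" "GDERIV f z :> g" "f z = a + c (z - y) / t" "\<And>w. f w \<le> a + c (w - y) / t"
  shows "y = z - t *\<^sub>R A g"
proof -
  have "g = B (z - y) /\<^sub>R t"
    by (rule gderiv_touching_eq[OF assms(2) gderiv_paraboloid]) (use assms(3,4) in auto)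
  then have "A g = (z - y) /\<^sub>R t"
    using A_B[of "(z - y) /\<^sub>R t"] by (simp add: linear_scale[OF linear_B])
  then show ?thesis using assms(1) by simp
qed

text \<open>A downward paraboloid centred at \<open>x\<close> is raised until it touches
  \<open>f\<close> from below near \<open>x\<close>. There semiconcavity supplies a touching
  paraboloid from above, and the sandwich gives a gradient.\<close>

lemma semiconcave_gderiv_dense:
  assumes f: "f \<in> Lip" "t > 0" "semiconcave t f" and "\<epsilon> > 0"
  obtains z g where "dist z x < \<epsilon>" "GDERIV f z :> g"
proof -
  obtain L where L: "L-lipschitz_on UNIV f" using f(1) by (auto simp: Lip_def)
  have L0: "L \<ge> 0" using L by (rule lipschitz_on_nonneg)
  \<comment> \<open>On the sphere of radius \<open>\<epsilon>\<close> the quadratic term is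
    \<open>(L + 1) * \<epsilon>\<close>, more than \<open>f\<close> can drop, so the contact point
    is interior.\<close>
  define N where "N = (L + 1) / \<epsilon>"
  have "continuous_on (cball x \<epsilon>) (\<lambda>w. f w + N * ((w - x) \<bullet> (w - x)))"
    by (intro continuous_intros Lip_continuous f)
  then obtain z where z: "z \<in> cball x \<epsilon>"
    and min: "\<And>w. w \<in> cball x \<epsilon> \<Longrightarrow> f z + N * ((z - x) \<bullet> (z - x)) \<le> f w + N * ((w - x) \<bullet> (w - x))"
    using continuous_attains_inf[of "cball x \<epsilon>"] \<open>\<epsilon> > 0\<close> by fastforce
  have "dist x z \<noteq> \<epsilon>"
  proof
    assume d: "dist x z = \<epsilon>"
    then have "(z - x) \<bullet> (z - x) = \<epsilon>\<^sup>2"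
      using power2_norm_eq_inner[of "z - x"] by (simp add: dist_norm norm_minus_commute)
    then have "N * ((z - x) \<bullet> (z - x)) = (L + 1) * \<epsilon>"
      using \<open>\<epsilon> > 0\<close> by (simp add: N_def power2_eq_square)
    moreover have "f x \<le> f z + L * \<epsilon>"
      using lipschitz_real_le[OF L, of x z] d by (simp add: dist_norm)
    ultimately show False
      using min[of x] \<open>\<epsilon> > 0\<close> distrib_right[of L 1 \<epsilon>] by simp
  qed
  with z have zb: "z \<in> ball x \<epsilon>" by simp
  obtain y where y: "f z = P t f y + c (z - y) / t" "\<And>w. f w \<le> P t f y + c (w - y) / t"
    using semiconcave_touching[OF f] by metis
  define l where "l w = f z + N * ((z - x) \<bullet> (z - x)) - N * ((w - x) \<bullet> (w - x))" for w
  have sub: "((\<lambda>w. w - x) has_derivative (\<lambda>h. h - 0)) (at z)"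
    by (intro has_derivative_diff has_derivative_ident has_derivative_const)
  have dl: "(l has_derivative (\<lambda>h. 0 - N * ((z - x) \<bullet> (h - 0) + (h - 0) \<bullet> (z - x)))) (at z)"
    unfolding l_def
    by (intro has_derivative_diff[OF has_derivative_const] has_derivative_mult_right
        has_derivative_inner[OF sub sub])
  have "0 - N * ((z - x) \<bullet> (h - 0) + (h - 0) \<bullet> (z - x)) = h \<bullet> (- (2 * N) *\<^sub>R (z - x))" for h
  proof -
    have "0 - N * (a + a) = - (2 * N) * a" for a :: real by simp
    then show ?thesis
      unfolding inner_commute[of "z - x" h] diff_0_right inner_scaleR_right .
  qed
  then have gl: "GDERIV l z :> - (2 * N) *\<^sub>R (z - x)"
    unfolding gderiv_def by (intro has_derivative_eq_rhs[OF dl] ext)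
  have "\<forall>\<^sub>F w in nhds z. w \<in> ball x \<epsilon>"
    using zb by (intro eventually_nhds_in_open) auto
  then have ev: "\<forall>\<^sub>F w in nhds z. l w \<le> f w \<and> f w \<le> P t f y + c (w - y) / t"
  proof eventually_elim
    case (elim w)
    then have "f z + N * ((z - x) \<bullet> (z - x)) \<le> f w + N * ((w - x) \<bullet> (w - x))"
      by (intro min) auto
    then show ?case using y(2)[of w] unfolding l_def by linarith
  qed
  have "l z = f z" by (simp add: l_def)
  from gderiv_sandwich[OF gl gderiv_paraboloid ev this y(1)[symmetric]]
  have "GDERIV f z :> - (2 * N) *\<^sub>R (z - x)" .
  then show ?thesis
    using that zb by (auto simp: dist_commute)
qed

text \<open>Feet at time \<open>0\<close> of the backward characteristics from points of
  differentiability.\<close>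

definition X :: "real \<Rightarrow> ('a \<Rightarrow> real) \<Rightarrow> 'a set" where
  "X t f = {z - t *\<^sub>R A g | z g. GDERIV f z :> g}"

lemma Q_eq_iff:
  assumes u: "u \<in> Lip" and f: "f \<in> Lip" "t > 0" "semiconcave t f"
  shows "Q t u = f \<longleftrightarrow> (\<forall>x. P t f x \<le> u x) \<and> (\<forall>x \<in> X t f. u x = P t f x)"
proof -
  obtain L where L: "L-lipschitz_on UNIV u" using u by (auto simp: Lip_def)
  note Qle = Q_le[OF L f(2)]
  have below: "P t f x \<le> u x" if eq: "Q t u = f" for x
  proof -
    obtain y where "P t f x = f y - c (y - x) / t"
      using P_attained[OF f(1,2)] by metis
    then show ?thesis using Qle[of y x] eq by simp
  qed
  have on_X: "u x = P t f x" if eq: "Q t u = f" and "x \<in> X t f" for x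
  proof -
    from \<open>x \<in> X t f\<close> obtain z g where z: "x = z - t *\<^sub>R A g" "GDERIV f z :> g" by (auto simp: X_def)
    obtain y where y: "f z = u y + c (z - y) / t"
      using Q_attained[OF L f(2)] eq by metis
    \<comment> \<open>The minimiser is the centre of a paraboloid touching \<open>f\<close> from
      above at \<open>z\<close>, and the gradient leaves only one such centre.\<close>
    then have "y = x"
      using touching_center[OF f(2) z(2) y] Qle eq z(1) by simp
    then have "u x \<le> P t f x"
      using y P_ge[OF f(1,2), of z x] by simp
    then show ?thesis using below[OF eq, of x] by simp
  qed
  have ge: "f x \<le> Q t u x" if *: "\<forall>x. P t f x \<le> u x" for x
  proof -
    obtain y where "Q t u x = u y + c (x - y) / t"
      using Q_attained[OF L f(2)] by metis
    moreover have "P t f y \<le> u y" using * by blast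
    ultimately show ?thesis using P_ge[OF f(1,2), of x y] by simp
  qed
  have at_diff: "Q t u z = f z"
    if *: "\<forall>x. P t f x \<le> u x" "\<forall>x \<in> X t f. u x = P t f x" and "GDERIV f z :> g" for z g
  proof -
    obtain y where y: "f z = P t f y + c (z - y) / t" "\<And>w. f w \<le> P t f y + c (w - y) / t"
      using semiconcave_touching[OF f] by metis
    have "y \<in> X t f"
      using touching_center[OF f(2) that(3) y] that(3) unfolding X_def by blast
    then have "u y = P t f y" using *(2) by blast
    then have "Q t u z \<le> f z" using Qle[of z y] y(1) by simp
    with ge[OF *(1), of z] show ?thesis by simp
  qed
  have "Q t u = f" if *: "\<forall>x. P t f x \<le> u x" "\<forall>x \<in> X t f. u x = P t f x"
  proof
    fix x
    have "closed {z. Q t u z = f z}"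
      by (intro closed_Collect_eq Lip_continuous Lip_Q u f)
    moreover have "x \<in> closure {z. Q t u z = f z}"
      unfolding closure_approachable
    proof (intro allI impI)
      fix \<epsilon> :: real assume "\<epsilon> > 0"
      then obtain z g where "dist z x < \<epsilon>" "GDERIV f z :> g"
        using semiconcave_gderiv_dense[OF f] by metis
      then show "\<exists>z\<in>{z. Q t u z = f z}. dist z x < \<epsilon>"
        using at_diff[OF *] by blast
    qed
    ultimately show "Q t u x = f x" by simp
  qed
  with below on_X show ?thesis by blast
qed

end

section \<open>Projection onto the reachable set\<close>

text \<open>The squared norm with values up to \<infinity>, on which monotonicity and additivity
  hold without case distinctions.\<close>

definition sq_int :: "('a::euclidean_space \<Rightarrow> real) \<Rightarrow> ennreal" where
  "sq_int f = (\<integral>\<^sup>+ x. ennreal ((f x)\<^sup>2) \<partial>lborel)"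

lemma L2_norm_power2: "(L2_norm f)\<^sup>2 = sq_int f"
proof (cases "sq_int f = \<infinity>")
  case True
  then have "L2_norm f = \<infinity>"
    by (simp add: L2_norm_def sq_int_def[symmetric])
  then show ?thesis
    using True by (simp add: power2_eq_square ennreal_top_mult)
next
  case False
  then have "L2_norm f = ennreal (sqrt (enn2real (sq_int f)))"
    by (simp add: L2_norm_def sq_int_def[symmetric])
  then have "(L2_norm f)\<^sup>2 = ennreal (enn2real (sq_int f))"
    by (simp add: ennreal_power)
  then show ?thesis
    using False by (simp add: less_top)
qed

lemma sq_int_mono: "(\<And>x. \<bar>f x\<bar> \<le> \<bar>g x\<bar>) \<Longrightarrow> sq_int f \<le> sq_int g"
  unfolding sq_int_def by (intro nn_integral_mono ennreal_leI) (simp add: abs_le_square_iff)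

lemma sq_int_finite:
  fixes f :: "'a::euclidean_space \<Rightarrow> real"
  assumes "f \<in> Lip0"
  shows "sq_int f < \<infinity>"
proof -
  obtain R where f: "f \<in> Lip" and R: "\<And>x. norm x > R \<Longrightarrow> f x = 0"
    using assms by (auto simp: Lip0_iff)
  obtain M where M: "M \<ge> 0" "\<And>x. norm x \<le> R \<Longrightarrow> \<bar>f x\<bar> \<le> M"
    using Lip_bounded_on_ball[OF f] by metis
  have "ennreal ((f x)\<^sup>2) \<le> ennreal (M\<^sup>2) * indicator (cball 0 R) x" for x
  proof (cases "norm x \<le> R")
    case True
    then have "(f x)\<^sup>2 \<le> M\<^sup>2"
      using M(1) M(2)[OF True] abs_le_square_iff[of "f x" M] by simp
    then show ?thesis using True by (simp add: ennreal_leI)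
  next
    case False
    then show ?thesis using R[of x] by simp
  qed
  then have "sq_int f \<le> (\<integral>\<^sup>+ x. ennreal (M\<^sup>2) * indicator (cball (0::'a) R) x \<partial>lborel)"
    unfolding sq_int_def by (rule nn_integral_mono)
  also have "\<dots> = ennreal (M\<^sup>2) * emeasure lborel (cball 0 R :: 'a set)"
    by (simp add: nn_integral_cmult_indicator)
  also have "\<dots> < \<infinity>"
    using emeasure_compact_finite[of "cball 0 R :: 'a set"] by (simp add: ennreal_mult_less_top)
  finally show ?thesis .
qed

text \<open>The set where \<open>f\<close> is nonzero is open and null, hence empty.\<close>

lemma sq_int_eq_0:
  fixes f :: "'a::euclidean_space \<Rightarrow> real"
  assumes "continuous_on UNIV f" "sq_int f = 0"
  shows "f x = 0"
proof -
  have meas: "f \<in> borel_measurable lborel"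
    using assms(1) borel_measurable_continuous_onI by simp
  have "AE x in lborel. f x = 0"
    using assms(2) meas unfolding sq_int_def
    by (subst (asm) nn_integral_0_iff_AE) auto
  moreover have op: "open {x. f x \<noteq> 0}"
    by (intro open_Collect_neq assms(1) continuous_on_const)
  then have "{x. f x \<noteq> 0} \<in> sets lborel"
    by simp
  ultimately have "{x. f x \<noteq> 0} \<in> null_sets lborel"
    using AE_iff_null[of lborel "\<lambda>x. f x = 0"] by simp
  then have "negligible {x. f x \<noteq> 0}"
    unfolding negligible_iff_null_sets by (rule null_sets_completionI)
  then show ?thesis
    using op open_not_negligible by blast
qed

text \<open>The parallelogram identity, arranged without subtraction so that it also holds for
  infinite values.\<close>

lemma sq_int_average:
  assumes "continuous_on UNIV f" "continuous_on UNIV g" "continuous_on UNIV u"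
  shows "2 * sq_int (\<lambda>x. (f x + g x) / 2 - u x) + 2 * sq_int (\<lambda>x. (f x - g x) / 2)
    = sq_int (\<lambda>x. f x - u x) + sq_int (\<lambda>x. g x - u x)"
proof -
  have [measurable]: "f \<in> borel_measurable borel" "g \<in> borel_measurable borel" "u \<in> borel_measurable borel"
    using assms borel_measurable_continuous_onI by auto
  have "2 * sq_int (\<lambda>x. (f x + g x) / 2 - u x) + 2 * sq_int (\<lambda>x. (f x - g x) / 2)
    = (\<integral>\<^sup>+ x. 2 * ennreal (((f x + g x) / 2 - u x)\<^sup>2) + 2 * ennreal (((f x - g x) / 2)\<^sup>2) \<partial>lborel)"
    unfolding sq_int_def by (subst nn_integral_add) (simp_all add: nn_integral_cmult)
  also have "\<dots> = (\<integral>\<^sup>+ x. ennreal ((f x - u x)\<^sup>2) + ennreal ((g x - u x)\<^sup>2) \<partial>lborel)"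
  proof (intro nn_integral_cong)
    fix x
    have two: "2 * ennreal a = ennreal (2 * a)" if "a \<ge> 0" for a
      using that by (simp add: ennreal_mult)
    have "2 * ((f x + g x) / 2 - u x)\<^sup>2 + 2 * ((f x - g x) / 2)\<^sup>2 = (f x - u x)\<^sup>2 + (g x - u x)\<^sup>2"
      by (simp add: power2_eq_square field_simps)
    then show "2 * ennreal (((f x + g x) / 2 - u x)\<^sup>2) + 2 * ennreal (((f x - g x) / 2)\<^sup>2)
        = ennreal ((f x - u x)\<^sup>2) + ennreal ((g x - u x)\<^sup>2)"
      by (simp add: two flip: ennreal_plus)
  qed
  also have "\<dots> = sq_int (\<lambda>x. f x - u x) + sq_int (\<lambda>x. g x - u x)"
    unfolding sq_int_def by (intro nn_integral_add) simp_all
  finally show ?thesis .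
qed

section \<open>Uniqueness of the projection\<close>

context quadratic_cost
begin

definition projection :: "real \<Rightarrow> ('a \<Rightarrow> real) \<Rightarrow> ('a \<Rightarrow> real) \<Rightarrow> bool" where
  "projection t u \<phi> \<longleftrightarrow> \<phi> \<in> Lip \<and> semiconcave t \<phi> \<and>
     (\<forall>\<psi> \<in> Lip. semiconcave t \<psi> \<longrightarrow> sq_int (\<lambda>x. \<phi> x - u x) \<le> sq_int (\<lambda>x. \<psi> x - u x))"

text \<open>The average of two minimisers is a competitor, so the parallelogram identity forces
  their distance to vanish.\<close>

lemma projection_unique:
  assumes \<phi>: "projection t u \<phi>" and u: "u \<in> Lip0" and t: "t > 0"
    and \<psi>: "\<psi> \<in> Lip" "semiconcave t \<psi>" "sq_int (\<lambda>x. \<psi> x - u x) \<le> sq_int (\<lambda>x. \<phi> x - u x)"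
  shows "\<psi> = \<phi>"
proof
  fix x
  have \<phi>': "\<phi> \<in> Lip" "semiconcave t \<phi>"
    and min: "\<And>\<psi>. \<psi> \<in> Lip \<Longrightarrow> semiconcave t \<psi> \<Longrightarrow> sq_int (\<lambda>x. \<phi> x - u x) \<le> sq_int (\<lambda>x. \<psi> x - u x)"
    using \<phi> by (auto simp: projection_def)
  have u': "u \<in> Lip" using u by (simp add: Lip0_def)
  define m where "m = sq_int (\<lambda>x. \<phi> x - u x)"
  \<comment> \<open>The zero function is a competitor at finite distance; finiteness of
    \<open>m\<close> permits the cancellation below.\<close>
  have zero: "(\<lambda>x. 0) \<in> Lip" "semiconcave t (\<lambda>x. 0)"
    using t by (auto simp: Lip_def lipschitz_on_def semiconcave_def intro!: exI[of _ 0])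
  have "(\<lambda>x. 0 - u x) \<in> Lip0"
    using u Lip_uminus[OF u'] by (simp add: Lip0_iff)
  then have fin: "m < \<infinity>"
    using min[OF zero] sq_int_finite unfolding m_def by (meson order_le_less_trans)
  have eq: "sq_int (\<lambda>x. \<psi> x - u x) = m"
    unfolding m_def by (intro antisym \<psi>(3) min \<psi>)
  have avg: "(\<lambda>x. (\<psi> x + \<phi> x) / 2) \<in> Lip"
    using Lip_cmult[OF Lip_add[OF \<psi>(1) \<phi>'(1)], of "1/2"] by simp
  have "m \<le> sq_int (\<lambda>x. (\<psi> x + \<phi> x) / 2 - u x)"
    unfolding m_def by (intro min avg semiconcave_average \<psi> \<phi>')
  then have "2 * m + 2 * sq_int (\<lambda>x. (\<psi> x - \<phi> x) / 2)
      \<le> 2 * sq_int (\<lambda>x. (\<psi> x + \<phi> x) / 2 - u x) + 2 * sq_int (\<lambda>x. (\<psi> x - \<phi> x) / 2)"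
    by (intro add_mono mult_left_mono) auto
  also have "\<dots> = m + m"
    using sq_int_average[of \<psi> \<phi> u] \<psi>(1) \<phi>'(1) u' eq by (simp add: Lip_continuous m_def)
  finally have "2 * m + 2 * sq_int (\<lambda>x. (\<psi> x - \<phi> x) / 2) \<le> 2 * m + 0"
    by (simp add: mult_2)
  then have "sq_int (\<lambda>x. (\<psi> x - \<phi> x) / 2) = 0"
    using fin by (subst (asm) ennreal_add_left_cancel_le) (auto simp: ennreal_mult_eq_top_iff)
  then have "(\<psi> x - \<phi> x) / 2 = 0"
    by (rule sq_int_eq_0[rotated]) (intro continuous_intros Lip_continuous \<psi> \<phi>', simp)
  then show "\<psi> x = \<phi> x" by simp
qed

text \<open>Turns uniqueness into a tool: a competitor pointwise no farther from \<open>u\<close> is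
  \<open>\<phi>\<close> itself, so properties of the competitor pass to
  \<open>\<phi>\<close>.\<close>

lemma projection_eqI:
  assumes "projection t u \<phi>" "u \<in> Lip0" "t > 0" "\<psi> \<in> Lip" "semiconcave t \<psi>"
    and "\<And>x. \<bar>\<psi> x - u x\<bar> \<le> \<bar>\<phi> x - u x\<bar>"
  shows "\<psi> = \<phi>"
  by (rule projection_unique[OF assms(1-5)]) (intro sq_int_mono assms(6))

section \<open>Compact support\<close>

lemma nonpos_outside_le_cost:
  assumes R: "\<And>x. norm x > R \<Longrightarrow> f x \<le> 0" and M: "M \<ge> 0" "\<And>x. norm x \<le> R \<Longrightarrow> \<bar>f x\<bar> \<le> M" and t: "t > 0"
    and x: "norm x > R + M * t / \<kappa> + 1"
  shows "f w \<le> c (w - x) / t"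
proof (cases "norm w \<le> R")
  case True
  \<comment> \<open>The summand \<open>1\<close> gives \<open>r \<ge> 1\<close>, so the squared
    distance dominates \<open>r\<close>.\<close>
  define r where "r = M * t / \<kappa> + 1"
  have r: "r \<ge> 1" "M * t \<le> \<kappa> * r" using M t kappa_pos by (simp_all add: r_def field_simps)
  have "norm (w - x) \<ge> r"
    using norm_triangle_ineq2[of x w] x True by (simp add: r_def norm_minus_commute)
  then have "r \<le> (norm (w - x))\<^sup>2"
    using r(1) self_le_power[of "norm (w - x)" 2] by simp
  then have "\<kappa> * r \<le> \<kappa> * (norm (w - x))\<^sup>2"
    using kappa_pos by (intro mult_left_mono) auto
  then have "\<kappa> * r \<le> c (w - x)"
    using c_ge[of "w - x"] by simp
  then have "M \<le> c (w - x) / t"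
    using r(2) t by (simp add: field_simps)
  then show ?thesis using M(2)[OF True] by simp
next
  case False
  then show ?thesis
    using order_trans[of "f w" 0 "c (w - x) / t"] R[of w] t by simp
qed

text \<open>Cutting \<open>\<phi>\<close> off at a compactly supported semiconcave majorant of \<open>\<phi>\<close> on a neighbourhood of
  the support of \<open>u\<close> brings it closer to \<open>u\<close>, so \<open>\<phi>\<close> lies below that majorant.\<close>

lemma projection_nonpos_outside:
  assumes \<phi>: "projection t u \<phi>" and u: "u \<in> Lip0" and t: "t > 0"
  obtains R where "R \<ge> 0" "\<And>x. norm x > R \<Longrightarrow> \<phi> x \<le> 0" "\<And>x. norm x > R \<Longrightarrow> u x = 0"
proof -
  have \<phi>': "\<phi> \<in> Lip" "semiconcave t \<phi>"
    using \<phi> by (auto simp: projection_def)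
  obtain R where R: "\<And>x. norm x > R \<Longrightarrow> u x = 0"
    using u by (auto simp: Lip0_iff)
  obtain M where M: "M \<ge> 0" "\<And>x. norm x \<le> R \<Longrightarrow> \<bar>\<phi> x\<bar> \<le> M"
    using Lip_bounded_on_ball[OF \<phi>'(1)] by metis
  \<comment> \<open>Inf-convolution lowers the tent by at most \<open>t / (4 * \<kappa>)\<close>;
    this height leaves at least \<open>M\<close> on the ball of radius \<open>R\<close>.\<close>
  define K where "K = max 0 R + t / (4 * \<kappa>) + M"
  have "0 \<le> t / (4 * \<kappa>)" using t kappa_pos by simp
  then have K: "K \<ge> R" "K \<ge> 0" using M(1) unfolding K_def by linarith+
  define g where "g = Q t (tent K)"
  obtain L where L: "L-lipschitz_on UNIV (tent K :: 'a \<Rightarrow> real)"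
    using Lip_tent by (auto simp: Lip_def)
  have g: "g \<in> Lip" "semiconcave t g"
    unfolding g_def by (intro Lip_Q semiconcave_Q Lip_tent t)+
  have g0: "0 \<le> g x" for x
  proof -
    obtain y where "g x = tent K y + c (x - y) / t"
      unfolding g_def using Q_attained[OF L t] by metis
    then show ?thesis using t by (simp add: tent_def)
  qed
  have gM: "M \<le> g x" if "norm x \<le> R" for x
  proof -
    obtain y where y: "g x = tent K y + c (x - y) / t"
      unfolding g_def using Q_attained[OF L t] by metis
    have "norm y \<le> norm x + norm (x - y)"
      using norm_triangle_ineq4[of x "x - y"] by simp
    moreover have "norm (x - y) \<le> c (x - y) / t + t / (4 * \<kappa>)"
      using young[OF t, of 1 "x - y"] by simp
    moreover have "K - norm y \<le> tent K y" by (simp add: tent_def)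
    ultimately show ?thesis using y that by (simp add: K_def)
  qed
  \<comment> \<open>On the ball the minimum is \<open>\<phi>\<close>; outside, \<open>u\<close>
    vanishes and \<open>g \<ge> 0\<close>, so cutting off only moves values towards
    \<open>u\<close>.\<close>
  have "(\<lambda>x. min (\<phi> x) (g x)) = \<phi>"
  proof (rule projection_eqI[OF \<phi> u t])
    show "(\<lambda>x. min (\<phi> x) (g x)) \<in> Lip" by (intro Lip_min \<phi>' g)
    show "semiconcave t (\<lambda>x. min (\<phi> x) (g x))" by (intro semiconcave_min \<phi>' g)
    fix x
    show "\<bar>min (\<phi> x) (g x) - u x\<bar> \<le> \<bar>\<phi> x - u x\<bar>"
    proof (cases "norm x \<le> R")
      case True
      then have "\<phi> x \<le> g x" using M(2)[of x] gM[of x] by simp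
      then show ?thesis by simp
    next
      case False
      then have "u x = 0" using R by simp
      then show ?thesis using g0[of x] by (simp add: min_def)
    qed
  qed
  then have \<phi>_le: "\<phi> x \<le> g x" for x by (metis min.cobounded2)
  have "g x \<le> 0" if "norm x > K" for x
    using Q_le[OF L t, of x x] that by (simp add: g_def tent_def)
  then have "\<phi> x \<le> 0" if "norm x > K" for x
    using order_trans[OF \<phi>_le] that by blast
  moreover have "u x = 0" if "norm x > K" for x
    using R[of x] K(1) that by linarith
  ultimately show ?thesis
    using that K(2) by blast
qed

text \<open>The maximum of \<open>\<phi>\<close> and a negative tent is not semiconcave; its semiconcave envelope
  still agrees with \<open>\<phi>\<close> near the support of \<open>u\<close> if the tent is deep and wide enough.\<close>

lemma projection_compact_support:
  assumes \<phi>: "projection t u \<phi>" and u: "u \<in> Lip0" and t: "t > 0"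
  shows "\<phi> \<in> Lip0"
proof -
  have \<phi>': "\<phi> \<in> Lip" "semiconcave t \<phi>"
    using \<phi> by (auto simp: projection_def)
  obtain R where R0: "R \<ge> 0" and R: "\<And>x. norm x > R \<Longrightarrow> \<phi> x \<le> 0" "\<And>x. norm x > R \<Longrightarrow> u x = 0"
    using projection_nonpos_outside[OF assms] by metis
  obtain M where M: "M \<ge> 0" "\<And>x. norm x \<le> R \<Longrightarrow> \<bar>\<phi> x\<bar> \<le> M"
    using Lip_bounded_on_ball[OF \<phi>'(1)] by metis
  \<comment> \<open>Beyond this radius the paraboloid \<open>c (w - x) / t\<close> centred at
    \<open>x\<close> lies above \<open>\<phi>\<close>, which keeps the envelope nonpositive at
    \<open>x\<close>.\<close>
  define R\<^sub>2 where "R\<^sub>2 = R + M * t / \<kappa> + 1"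
  have far: "\<phi> w \<le> c (w - x) / t" if "norm x > R\<^sub>2" for x w
    using nonpos_outside_le_cost[OF R(1) M t, where x = x and w = w] that by (simp add: R\<^sub>2_def)
  obtain L where L: "L-lipschitz_on UNIV (P t \<phi>)"
    using Lip_P[OF \<phi>'(1) t] by (auto simp: Lip_def)
  define D where "D = L * t / \<kappa>"
  obtain E where E: "\<And>x. norm x \<le> R\<^sub>2 + D \<Longrightarrow> \<bar>P t \<phi> x\<bar> \<le> E"
    using Lip_bounded_on_ball[OF Lip_P[OF \<phi>'(1) t]] by metis
  \<comment> \<open>\<open>D\<close> bounds the distance from \<open>x\<close> to its touching
    centre and \<open>E\<close> the size of \<open>P t \<phi>\<close> at such centres. With this
    depth every paraboloid touching \<open>\<phi>\<close> within radius \<open>R\<^sub>2\<close>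
    also lies above the negative tent.\<close>
  define K where "K = R\<^sub>2 + D + E + t / (4 * \<kappa>)"
  define f where "f x = max (\<phi> x) (- tent K x)" for x
  have f: "f \<in> Lip"
    unfolding f_def[abs_def] by (intro Lip_max Lip_uminus Lip_tent \<phi>')
  have near: "Q t (P t f) x \<le> \<phi> x" if "norm x \<le> R\<^sub>2" for x
  proof -
    obtain y where y: "norm (x - y) \<le> D" "\<phi> x = P t \<phi> y + c (x - y) / t"
      using Q_attained[OF L t, of x] Q_P_eq[OF \<phi>'(1) t \<phi>'(2)] unfolding D_def by metis
    have ny: "norm y \<le> R\<^sub>2 + D"
      using norm_triangle_ineq4[of x "x - y"] that y(1) by simp
    have "f w \<le> P t \<phi> y + c (w - y) / t" for w
    proof -
      have "\<phi> w \<le> P t \<phi> y + c (w - y) / t"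
        using P_ge[OF \<phi>'(1) t, of w y] by simp
      moreover have "norm w \<le> norm y + norm (w - y)"
        using norm_triangle_ineq[of y "w - y"] by simp
      moreover have "norm (w - y) \<le> c (w - y) / t + t / (4 * \<kappa>)"
        using young[OF t, of 1 "w - y"] by simp
      moreover have "K - norm w \<le> tent K w" by (simp add: tent_def)
      moreover have "- E \<le> P t \<phi> y" using E[OF ny] by simp
      ultimately show ?thesis
        using ny unfolding f_def K_def by simp
    qed
    then show ?thesis
      using Q_P_le[OF f t] y(2) by metis
  qed
  have outer: "Q t (P t f) x \<le> 0" if "norm x > R\<^sub>2" for x
  proof -
    have "f w \<le> 0 + c (w - x) / t" for w
    proof -
      have "0 \<le> c (w - x) / t" "0 \<le> tent K w" using t by (simp_all add: tent_def)
      then show ?thesis using far[OF that, of w] by (simp add: f_def)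
    qed
    from Q_P_le[OF f t this, of x] show ?thesis by simp
  qed
  have above: "\<phi> x \<le> Q t (P t f) x" "- tent K x \<le> Q t (P t f) x" for x
    using Q_P_ge[OF f t, of x] by (auto simp: f_def)
  \<comment> \<open>The envelope agrees with \<open>\<phi>\<close> up to radius
    \<open>R\<^sub>2\<close>; beyond, it lies between \<open>\<phi>\<close> and
    \<open>0 = u\<close>.\<close>
  have "Q t (P t f) = \<phi>"
  proof (rule projection_eqI[OF \<phi> u t])
    show "Q t (P t f) \<in> Lip" "semiconcave t (Q t (P t f))"
      by (intro Lip_Q Lip_P semiconcave_Q f t)+
    show "\<bar>Q t (P t f) x - u x\<bar> \<le> \<bar>\<phi> x - u x\<bar>" for x
    proof (cases "norm x \<le> R\<^sub>2")
      case True
      then show ?thesis using near[OF True] above(1)[of x] by simp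
    next
      case False
      moreover have "0 \<le> M * t / \<kappa>" using M(1) t kappa_pos by simp
      ultimately have "norm x > R" unfolding R\<^sub>2_def by linarith
      then show ?thesis
        using R(2)[of x] outer[of x] above(1)[of x] False by simp
    qed
  qed
  then have ge: "- tent K x \<le> \<phi> x" for x using above(2)[of x] by simp
  have "\<phi> x = 0" if "norm x > max K R" for x
    using R(1)[of x] ge[of x] that by (simp add: tent_def)
  then show ?thesis
    using \<phi>'(1) unfolding Lip0_iff by blast
qed

text \<open>Far out the cost of reaching the support of \<open>f\<close> outweighs its values, while
  staying at \<open>x\<close> yields \<open>0\<close>.\<close>

lemma P_compact_support:
  assumes "f \<in> Lip0" "t > 0"
  shows "P t f \<in> Lip0"
proof -
  obtain R where f: "f \<in> Lip" and R: "\<And>x. norm x > R \<Longrightarrow> f x = 0"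
    using assms by (auto simp: Lip0_iff)
  obtain M where M: "M \<ge> 0" "\<And>x. norm x \<le> R \<Longrightarrow> \<bar>f x\<bar> \<le> M"
    using Lip_bounded_on_ball[OF f] by metis
  have "P t f x = 0" if "norm x > R + M * t / \<kappa> + 1" for x
  proof (rule antisym)
    obtain y where "P t f x = f y - c (y - x) / t"
      using P_attained[OF f assms(2)] by metis
    moreover have "f y \<le> c (y - x) / t"
      by (rule nonpos_outside_le_cost[OF _ M(1) _ assms(2) that]) (use R M(2) in auto)
    ultimately show "P t f x \<le> 0" by simp
    have "0 \<le> M * t / \<kappa>" using M(1) assms(2) kappa_pos by simp
    then have "R < norm x" using that by linarith
    then show "0 \<le> P t f x"
      using P_ge[OF f assms(2), of x x] R[of x] by simp
  qed
  then show ?thesis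
    using Lip_P[OF f assms(2)] unfolding Lip0_iff by blast
qed

text \<open>Where \<open>f\<close> vanishes locally, the gradient is zero and the characteristic
  stands still.\<close>

lemma X_outside:
  assumes "f \<in> Lip0"
  obtains R where "\<And>x. norm x > R \<Longrightarrow> x \<in> X t f"
proof -
  obtain R where R: "\<And>x. norm x > R \<Longrightarrow> f x = 0"
    using assms by (auto simp: Lip0_iff)
  have A0: "A 0 = 0" using A_B[of 0] linear_0[OF linear_B] by simp
  have "x \<in> X t f" if "norm x > R" for x
  proof -
    have op: "open {y::'a. norm y > R}" by (intro open_Collect_less continuous_intros)
    have "((\<lambda>y. 0::real) has_derivative (\<lambda>h. h \<bullet> 0)) (at x)" by simp
    then have "(f has_derivative (\<lambda>h. h \<bullet> 0)) (at x)"
      by (rule has_derivative_transform_within_open[OF _ op]) (use that R in auto)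
    then have "GDERIV f x :> 0" by (simp add: gderiv_def)
    then show ?thesis
      unfolding X_def using A0 by (intro CollectI exI[of _ x] exI[of _ 0]) simp
  qed
  then show ?thesis using that by blast
qed


section \<open>Characterisation of the minimisers\<close>

lemma arg_min_imp_projection:
  assumes "T > 0"
    and "is_arg_min (\<lambda>\<phi>. L2_norm (\<lambda>x. \<phi> x - u x)) (\<lambda>\<phi>. \<phi> \<in> reachable_set H T) \<phi>"
  shows "projection T u \<phi>"
proof -
  have \<phi>: "\<phi> \<in> Lip" "semiconcave T \<phi>"
    and le: "\<And>\<psi>. \<psi> \<in> Lip \<Longrightarrow> semiconcave T \<psi> \<Longrightarrow> L2_norm (\<lambda>x. \<phi> x - u x) \<le> L2_norm (\<lambda>x. \<psi> x - u x)"
    using assms(2) unfolding is_arg_min_def reachable_set_eq[OF assms(1)] by (auto simp: not_less)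
  have "sq_int (\<lambda>x. \<phi> x - u x) \<le> sq_int (\<lambda>x. \<psi> x - u x)" if "\<psi> \<in> Lip" "semiconcave T \<psi>" for \<psi>
    using power_mono[OF le[OF that], of 2] by (simp add: L2_norm_power2)
  with \<phi> show ?thesis by (simp add: projection_def)
qed

text \<open>\<open>P T \<phi>\<close> is admissible and evolves to \<open>\<phi>\<close>, so the
  minimum over data of compact support is the distance to the reachable set, and uniqueness of the
  projection applies.\<close>

lemma arg_min_iff:
  assumes \<phi>: "projection T u \<phi>" and u: "u \<in> Lip0" and T: "T > 0"
  shows "is_arg_min (\<lambda>v. (L2_norm (\<lambda>x. S_plus H T v x - u x))\<^sup>2) (\<lambda>v. v \<in> Lip0) v
    \<longleftrightarrow> v \<in> Lip0 \<and> Q T v = \<phi>"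
proof -
  have \<phi>': "\<phi> \<in> Lip" "semiconcave T \<phi>"
    and min: "\<And>\<psi>. \<psi> \<in> Lip \<Longrightarrow> semiconcave T \<psi> \<Longrightarrow> sq_int (\<lambda>x. \<phi> x - u x) \<le> sq_int (\<lambda>x. \<psi> x - u x)"
    using \<phi> by (auto simp: projection_def)
  have val: "(L2_norm (\<lambda>x. S_plus H T w x - u x))\<^sup>2 = sq_int (\<lambda>x. Q T w x - u x)" if "w \<in> Lip0" for w
    using that S_plus_eq[of w T] T by (simp add: L2_norm_power2 Lip0_def)
  have P: "P T \<phi> \<in> Lip0" "Q T (P T \<phi>) = \<phi>"
    using P_compact_support[OF projection_compact_support[OF \<phi> u T] T] Q_P_eq[OF \<phi>'(1) T \<phi>'(2)] by auto
  have Q: "Q T w \<in> Lip" "semiconcave T (Q T w)" if "w \<in> Lip0" for w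
    using that T by (auto simp: Lip0_def Lip_Q semiconcave_Q)
  show ?thesis
  proof
    assume "is_arg_min (\<lambda>v. (L2_norm (\<lambda>x. S_plus H T v x - u x))\<^sup>2) (\<lambda>v. v \<in> Lip0) v"
    then have v: "v \<in> Lip0"
      and "(L2_norm (\<lambda>x. S_plus H T v x - u x))\<^sup>2 \<le> (L2_norm (\<lambda>x. S_plus H T (P T \<phi>) x - u x))\<^sup>2"
      using P(1) by (auto simp: is_arg_min_def not_less)
    then have "sq_int (\<lambda>x. Q T v x - u x) \<le> sq_int (\<lambda>x. \<phi> x - u x)"
      using P by (simp only: val)
    then show "v \<in> Lip0 \<and> Q T v = \<phi>"
      using v projection_unique[OF \<phi> u T Q[OF v]] by blast
  next
    assume v: "v \<in> Lip0 \<and> Q T v = \<phi>"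
    have "sq_int (\<lambda>x. Q T v x - u x) \<le> sq_int (\<lambda>x. Q T w x - u x)" if "w \<in> Lip0" for w
      using v min[OF Q[OF that]] by simp
    then show "is_arg_min (\<lambda>v. (L2_norm (\<lambda>x. S_plus H T v x - u x))\<^sup>2) (\<lambda>v. v \<in> Lip0) v"
      using v by (auto simp: is_arg_min_def not_less val)
  qed
qed

text \<open>Compact support of \<open>v\<close> is automatic from right to left: far out
  \<open>\<eta>\<close> vanishes because \<open>X t f\<close> covers a neighbourhood of infinity,
  and \<open>P t f\<close> vanishes as well.\<close>

lemma Lip0_Q_eq_iff:
  assumes "f \<in> Lip0" "t > 0" "semiconcave t f"
  shows "v \<in> Lip0 \<and> Q t v = f \<longleftrightarrow>
    (\<exists>\<eta>. v = (\<lambda>x. P t f x + \<eta> x) \<and> \<eta> \<in> Lip \<and> (\<forall>x. 0 \<le> \<eta> x) \<and> support_on UNIV \<eta> \<subseteq> UNIV - X t f)"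
    (is "?L \<longleftrightarrow> (\<exists>\<eta>. ?R \<eta>)")
proof (intro iffI)
  have f: "f \<in> Lip" using assms(1) by (simp add: Lip0_def)
  assume v: "v \<in> Lip0 \<and> Q t v = f"
  then have vL: "v \<in> Lip" by (simp add: Lip0_def)
  have *: "\<forall>x. P t f x \<le> v x" "\<forall>x \<in> X t f. v x = P t f x"
    using v Q_eq_iff[OF vL f assms(2,3)] by simp_all
  have "(\<lambda>x. v x - P t f x) \<in> Lip"
    by (intro Lip_diff vL Lip_P[OF f assms(2)])
  moreover have "support_on UNIV (\<lambda>x. v x - P t f x) \<subseteq> UNIV - X t f"
    using *(2) by (auto simp: support_on_def)
  ultimately show "\<exists>\<eta>. ?R \<eta>"
    using *(1) by (intro exI[of _ "\<lambda>x. v x - P t f x"]) simp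
next
  have f: "f \<in> Lip" using assms(1) by (simp add: Lip0_def)
  have P: "P t f \<in> Lip" by (rule Lip_P[OF f assms(2)])
  assume "\<exists>\<eta>. ?R \<eta>"
  then obtain \<eta> where v: "v = (\<lambda>x. P t f x + \<eta> x)" and \<eta>: "\<eta> \<in> Lip" "\<And>x. 0 \<le> \<eta> x"
    and supp: "support_on UNIV \<eta> \<subseteq> UNIV - X t f"
    by blast
  have X0: "\<eta> x = 0" if "x \<in> X t f" for x
    using supp that by (auto simp: support_on_def)
  obtain R where R: "\<And>x. norm x > R \<Longrightarrow> x \<in> X t f"
    using X_outside[OF assms(1)] by metis
  obtain R' where R': "\<And>x. norm x > R' \<Longrightarrow> P t f x = 0"
    using P_compact_support[OF assms(1,2)] by (auto simp: Lip0_iff)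
  have vL: "v \<in> Lip" unfolding v by (intro Lip_add P \<eta>)
  moreover have "v x = 0" if "norm x > max R R'" for x
    using that R[of x] R'[of x] X0[of x] by (simp add: v)
  ultimately have "v \<in> Lip0"
    unfolding Lip0_iff by blast
  moreover have "Q t v = f"
    using Q_eq_iff[OF vL f assms(2,3)] \<eta>(2) X0 by (simp add: v)
  ultimately show "v \<in> Lip0 \<and> Q t v = f" by simp
qed

lemma P_eq_SUP:
  assumes "f \<in> Lip" "t > 0"
  shows "(SUP y. f y - c (y - x) / t) = P t f x"
proof -
  obtain y where y: "P t f x = f y - c (y - x) / t"
    using P_attained[OF assms] by metis
  show ?thesis
  proof (rule cSup_eq_maximum)
    show "P t f x \<in> range (\<lambda>y. f y - c (y - x) / t)"
      unfolding y by (rule rangeI)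
  qed (use P_ge[OF assms, of _ x] in auto)
qed

end

section \<open>Specialisation to positive definite matrices\<close>

text \<open>The constant \<open>\<kappa>\<close> is the minimum of the positive cost on the unit
  sphere, extended to all vectors by homogeneity of degree two.\<close>

lemma positive_definite_quadratic_cost:
  fixes A :: "real^'n^'n"
  assumes "positive_definite A"
  shows "\<exists>\<kappa>. quadratic_cost ((*v) A) ((*v) (matrix_inv A)) \<kappa>"
proof -
  have sym: "(A *v x) \<bullet> y = x \<bullet> (A *v y)" for x y
    using assms dot_lmul_matrix[of x A y] by (simp add: positive_definite_def flip: transpose_matrix_vector)
  have pos: "(A *v p) \<bullet> p > 0" if "p \<noteq> 0" for p
    using assms that by (simp add: positive_definite_def)
  have "invertible A"
    unfolding invertible_left_inverse matrix_left_invertible_ker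
    using pos by (metis inner_zero_left less_irrefl)
  then have "A ** matrix_inv A = mat 1 \<and> matrix_inv A ** A = mat 1"
    unfolding invertible_def matrix_inv_def by (rule someI_ex)
  then have AB: "A *v (matrix_inv A *v x) = x" and BA: "matrix_inv A *v (A *v x) = x" for x
    by (simp_all add: matrix_vector_mul_assoc)
  define q where "q z = ((matrix_inv A *v z) \<bullet> z) / 2" for z :: "real^'n"
  have q_pos: "q z > 0" if "z \<noteq> 0" for z
  proof -
    have "matrix_inv A *v z \<noteq> 0" using AB[of z] that by auto
    from pos[OF this] show ?thesis by (simp add: q_def AB inner_commute)
  qed
  have "continuous_on (sphere 0 1) q"
    unfolding q_def by (intro continuous_intros linear_continuous_on_compose matrix_vector_mul_linear) auto
  moreover have "axis undefined 1 \<in> sphere (0 :: real^'n) 1"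
    by simp
  ultimately obtain z\<^sub>0 where z0: "z\<^sub>0 \<in> sphere 0 1" "\<And>z. z \<in> sphere 0 1 \<Longrightarrow> q z\<^sub>0 \<le> q z"
    using continuous_attains_inf[of "sphere 0 1" q] by (metis compact_sphere empty_iff)
  have "q z\<^sub>0 * (norm z)\<^sup>2 \<le> q z" for z
  proof (cases "z = 0")
    case False
    have *: "q (z /\<^sub>R norm z) = q z / (norm z)\<^sup>2"
      by (simp add: q_def matrix_vector_mult_scaleR power2_eq_square field_simps)
    have "q z\<^sub>0 \<le> q (z /\<^sub>R norm z)"
      using False by (intro z0(2)) simp
    then show ?thesis
      unfolding * using False by (simp add: pos_le_divide_eq)
  qed (simp add: q_def)
  moreover have "q z\<^sub>0 > 0"
    using z0(1) by (intro q_pos) auto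
  ultimately have "quadratic_cost ((*v) A) ((*v) (matrix_inv A)) (q z\<^sub>0)"
  proof unfold_locales
    show "(matrix_inv A *v x) \<bullet> y = x \<bullet> (matrix_inv A *v y)" for x y
      using sym[of "matrix_inv A *v x" "matrix_inv A *v y"] by (simp add: AB)
  qed (auto simp: AB BA q_def matrix_vector_right_distrib matrix_vector_mult_scaleR)
  then show ?thesis by blast
qed

theorem corollary2:
  fixes A :: "real^'n^'n" and T :: real and u_T \<phi>_star :: "real^'n \<Rightarrow> real"
  assumes "T > 0"
    and "positive_definite A"
    and "u_T \<in> Lip0"
    and "is_arg_min (\<lambda>\<phi>. L2_norm (\<lambda>x. \<phi> x - u_T x))
           (\<lambda>\<phi>. \<phi> \<in> reachable_set (quadratic_hamiltonian A) T) \<phi>_star"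
  shows "{u0. is_arg_min (\<lambda>u. (L2_norm (\<lambda>x. S_plus (quadratic_hamiltonian A) T u x - u_T x))\<^sup>2)
                (\<lambda>u. u \<in> Lip0) u0}
           = I_set A T \<phi>_star
         \<and> I_set A T \<phi>_star \<subseteq> Lip
         \<and> convex_cone_with_vertex (u0_tilde A T \<phi>_star) (I_set A T \<phi>_star)"
proof -
  obtain \<kappa> where "quadratic_cost ((*v) A) ((*v) (matrix_inv A)) \<kappa>"
    using positive_definite_quadratic_cost[OF assms(2)] by blast
  then interpret quadratic_cost "(*v) A" "(*v) (matrix_inv A)" \<kappa> .
  have ham: "quadratic_hamiltonian A = H"
    by (simp add: fun_eq_iff quadratic_hamiltonian_def H_def)
  have proj: "projection T u_T \<phi>_star"
    using arg_min_imp_projection[OF assms(1)] assms(4) unfolding ham .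
  have \<phi>0: "\<phi>_star \<in> Lip0"
    by (rule projection_compact_support[OF proj assms(3,1)])
  have \<phi>: "\<phi>_star \<in> Lip" "semiconcave T \<phi>_star"
    using proj by (auto simp: projection_def)
  have u0: "u0_tilde A T \<phi>_star = P T \<phi>_star"
    using P_eq_SUP[OF \<phi>(1) assms(1)] by (simp add: fun_eq_iff u0_tilde_def c_def)
  have X: "X_set A T \<phi>_star = X T \<phi>_star"
    by (simp add: X_set_def X_def)
  have PL: "P T \<phi>_star \<in> Lip"
    by (rule Lip_P[OF \<phi>(1) assms(1)])
  have "{u0. is_arg_min (\<lambda>u. (L2_norm (\<lambda>x. S_plus (quadratic_hamiltonian A) T u x - u_T x))\<^sup>2)
                (\<lambda>u. u \<in> Lip0) u0} = I_set A T \<phi>_star"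
    unfolding ham arg_min_iff[OF proj assms(3,1)] Lip0_Q_eq_iff[OF \<phi>0 assms(1) \<phi>(2)] I_set_def u0 X by simp
  moreover have "I_set A T \<phi>_star \<subseteq> Lip"
    using Lip_add[OF PL] by (auto simp: I_set_def u0)
  moreover have "convex_cone_with_vertex (u0_tilde A T \<phi>_star) (I_set A T \<phi>_star)"
    unfolding convex_cone_with_vertex_def
  proof (intro conjI ballI allI impI)
    have "(\<lambda>x. 0) \<in> Lip" by (auto simp: Lip_def lipschitz_on_def)
    then show "u0_tilde A T \<phi>_star \<in> I_set A T \<phi>_star"
      unfolding I_set_def by (intro CollectI exI[of _ "\<lambda>x. 0"]) (simp add: support_on_def)
    fix f g and a b :: real
    assume "f \<in> I_set A T \<phi>_star" "g \<in> I_set A T \<phi>_star" and ab: "0 \<le> a" "0 \<le> b"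
    then obtain \<eta> \<theta> where fg: "f = (\<lambda>x. u0_tilde A T \<phi>_star x + \<eta> x)" "g = (\<lambda>x. u0_tilde A T \<phi>_star x + \<theta> x)"
      and Lip: "\<eta> \<in> Lip" "\<theta> \<in> Lip" and nn: "\<And>x. 0 \<le> \<eta> x" "\<And>x. 0 \<le> \<theta> x"
      and supp: "support_on UNIV \<eta> \<subseteq> UNIV - X_set A T \<phi>_star" "support_on UNIV \<theta> \<subseteq> UNIV - X_set A T \<phi>_star"
      unfolding I_set_def by blast
    have "(\<lambda>x. a * \<eta> x + b * \<theta> x) \<in> Lip"
      by (intro Lip_add Lip_cmult Lip)
    moreover have "0 \<le> a * \<eta> x + b * \<theta> x" for x
      using ab nn by simp
    moreover have "support_on UNIV (\<lambda>x. a * \<eta> x + b * \<theta> x) \<subseteq> UNIV - X_set A T \<phi>_star"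
    proof -
      have "a * \<eta> x + b * \<theta> x = 0" if "x \<in> X_set A T \<phi>_star" for x
      proof -
        have "\<eta> x = 0" "\<theta> x = 0"
          using supp that by (auto simp: support_on_def)
        then show ?thesis by simp
      qed
      then show ?thesis by (auto simp: support_on_def)
    qed
    ultimately show "(\<lambda>x. u0_tilde A T \<phi>_star x + a * (f x - u0_tilde A T \<phi>_star x)
        + b * (g x - u0_tilde A T \<phi>_star x)) \<in> I_set A T \<phi>_star"
      unfolding I_set_def fg by (intro CollectI exI[of _ "\<lambda>x. a * \<eta> x + b * \<theta> x"]) (simp add: add.assoc)
  qed
  ultimately show ?thesis by blast
qed

end
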